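(* Let a group $G$ act by automorphisms on a bounded valence hyperbolic graph $\Gamma$ with some point having a finite stabiliser. Then exactly one of the following occurs: (i) $G$ is finite; (ii) $G$ is infinite but virtually cyclic and contains a loxodromic element; (iii) $G$ is not finitely generated, is locally finite, and acts parabolically with all elements elliptic; (iv) the action of $G$ on $\Gamma$ is general.
   Context: A hyperbolic graph is a connected graph which is Gromov hyperbolic with its path metric (edges of length 1); bounded valence means there is a uniform upper bound on the degrees of vertices. $G$ is an arbitrary abstract group. A group is locally finite if every finitely generated subgroup is finite. For an isometric action on a hyperbolic space $X$: $g$ is elliptic if $\langle g\rangle$ has bounded orbits; $g$ is loxodromic if $\lim_{n\to\infty}d(g^n(x),x)/n>0$, in which case it has exactly two limit points in $\partial X$. The limit set $\partial_G X$ is the set of accumulation points of a $G$-orbit in the Gromov boundary $\partial X$. The action is parabolic if $\partial_G X$ has exactly one point, and general if $\partial_G X$ is infinite and $G$ contains two loxodromic elements whose limit sets (pairs of limit points) are disjoint. *)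

theory Defs
  imports "HOL-Analysis.Analysis" "HOL-Algebra.Algebra"
begin

section \<open>Graphs with their path metric\<close>

locale simple_graph =
  fixes V :: "'v set" and E :: "'v set set"
  assumes edges: "e \<in> E \<Longrightarrow> \<exists>u\<in>V. \<exists>v\<in>V. u \<noteq> v \<and> e = {u, v}"

definition walk_betw :: "'v set \<Rightarrow> 'v set set \<Rightarrow> 'v \<Rightarrow> 'v list \<Rightarrow> 'v \<Rightarrow> bool" where
  "walk_betw V E u p v \<longleftrightarrow>
     p \<noteq> [] \<and> hd p = u \<and> last p = v \<and> set p \<subseteq> V \<and> successively (\<lambda>x y. {x, y} \<in> E) p"

locale connected_graph = simple_graph +
  assumes connected: "u \<in> V \<Longrightarrow> v \<in> V \<Longrightarrow> \<exists>p. walk_betw V E u p v"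

text \<open>
  The metric space of a graph is its vertex set with the path metric, edges having length 1.
  A walk \<open>p\<close>, given as its list of vertices, has \<open>length p - 1\<close> edges.
\<close>

definition graph_dist :: "'v set \<Rightarrow> 'v set set \<Rightarrow> 'v \<Rightarrow> 'v \<Rightarrow> real" where
  "graph_dist V E u v = real (LEAST n. \<exists>p. walk_betw V E u p v \<and> length p = Suc n)"

lemma walk_betw_rev: "walk_betw V E u p v \<Longrightarrow> walk_betw V E v (rev p) u"
  by (auto simp: walk_betw_def hd_rev last_rev insert_commute)

lemma walk_betw_append:
  assumes "walk_betw V E u p v" "walk_betw V E v q w"
  shows "walk_betw V E u (p @ tl q) w"
proof (cases q)
  case Nil
  with assms show ?thesis by (simp add: walk_betw_def)
next
  case (Cons a q')
  with assms show ?thesis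
    by (cases q') (auto simp: walk_betw_def successively_append_iff)
qed

lemma graph_dist_le:
  assumes "walk_betw V E u p v" "length p = Suc n"
  shows "graph_dist V E u v \<le> real n"
  unfolding graph_dist_def of_nat_le_iff by (rule Least_le) (use assms in blast)

context connected_graph
begin

lemma shortest_walk:
  assumes "u \<in> V" "v \<in> V"
  obtains p n where "walk_betw V E u p v" "length p = Suc n" "graph_dist V E u v = real n"
proof -
  obtain p where p: "walk_betw V E u p v"
    using connected assms by blast
  then have "length p = Suc (length p - 1)"
    by (auto simp: walk_betw_def)
  with p have "\<exists>n p. walk_betw V E u p v \<and> length p = Suc n"
    by blast
  from LeastI_ex[OF this] show ?thesis
    using that unfolding graph_dist_def by blast
qed

lemma Metric_space_graph_dist: "Metric_space V (graph_dist V E)"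
proof
  show "0 \<le> graph_dist V E u v" for u v
    by (simp add: graph_dist_def)
  have "(\<exists>p. walk_betw V E u p v \<and> length p = Suc n) \<longleftrightarrow>
        (\<exists>p. walk_betw V E v p u \<and> length p = Suc n)" for u v n
    by (metis walk_betw_rev length_rev)
  then show "graph_dist V E u v = graph_dist V E v u" for u v
    by (simp add: graph_dist_def)
next
  fix u v assume uv: "u \<in> V" "v \<in> V"
  show "graph_dist V E u v = 0 \<longleftrightarrow> u = v"
  proof
    assume "graph_dist V E u v = 0"
    with shortest_walk[OF uv] obtain p where "walk_betw V E u p v" "length p = Suc 0"
      by (metis of_nat_eq_0_iff)
    then show "u = v"
      by (auto simp: walk_betw_def length_Suc_conv)
  next
    assume "u = v"
    with uv have "walk_betw V E u [u] v" "length [u] = Suc 0"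
      by (auto simp: walk_betw_def)
    from graph_dist_le[OF this] show "graph_dist V E u v = 0"
      by (simp add: graph_dist_def)
  qed
next
  fix u v w assume V: "u \<in> V" "v \<in> V" "w \<in> V"
  obtain p m where p: "walk_betw V E u p v" "length p = Suc m" "graph_dist V E u v = real m"
    using shortest_walk V by metis
  obtain q n where q: "walk_betw V E v q w" "length q = Suc n" "graph_dist V E v w = real n"
    using shortest_walk V by metis
  have "length (p @ tl q) = Suc (m + n)"
    using p q by simp
  from graph_dist_le[OF walk_betw_append[OF p(1) q(1)] this]
  show "graph_dist V E u w \<le> graph_dist V E u v + graph_dist V E v w"
    using p q by simp
qed

end

definition bounded_valence :: "'v set \<Rightarrow> 'v set set \<Rightarrow> bool" where
  "bounded_valence V E \<longleftrightarrow>
     (\<exists>k. \<forall>v\<in>V. finite {u. {u, v} \<in> E} \<and> card {u. {u, v} \<in> E} \<le> k)"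

text \<open>
  The points of the geometric realisation (vertices and points in the interior of edges), in
  barycentric coordinates: non-negative weights on the vertices, of total weight 1, whose
  support is a single vertex or the set of the two endpoints of an edge.
\<close>

definition realization_points :: "'v set \<Rightarrow> 'v set set \<Rightarrow> ('v \<Rightarrow> real) set" where
  "realization_points V E =
     {p. (\<forall>v. p v \<ge> 0) \<and> {v. p v \<noteq> 0} \<in> (\<lambda>v. {v}) ` V \<union> E \<and> (\<Sum>v | p v \<noteq> 0. p v) = 1}"

definition realization_action ::
  "('g, 'c) monoid_scheme \<Rightarrow> 'v set \<Rightarrow> ('g \<Rightarrow> 'v \<Rightarrow> 'v) \<Rightarrow> 'g \<Rightarrow> ('v \<Rightarrow> real) \<Rightarrow> 'v \<Rightarrow> real" where
  "realization_action G V \<phi> g p = (\<lambda>v. if v \<in> V then p (\<phi> (inv\<^bsub>G\<^esub> g) v) else 0)"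

locale graph_action = simple_graph V E + group_action G V \<phi>
  for V :: "'v set" and E :: "'v set set"
    and G :: "('g, 'c) monoid_scheme" (structure) and \<phi> :: "'g \<Rightarrow> 'v \<Rightarrow> 'v" +
  assumes automorphism:
    "g \<in> carrier G \<Longrightarrow> u \<in> V \<Longrightarrow> v \<in> V \<Longrightarrow> {\<phi> g u, \<phi> g v} \<in> E \<longleftrightarrow> {u, v} \<in> E"


section \<open>Hyperbolic spaces and the Gromov boundary\<close>

definition gromov_product :: "('a \<Rightarrow> 'a \<Rightarrow> real) \<Rightarrow> 'a \<Rightarrow> 'a \<Rightarrow> 'a \<Rightarrow> real" where
  "gromov_product d w x y = (d x w + d y w - d x y) / 2"

definition gromov_hyperbolic :: "'a set \<Rightarrow> ('a \<Rightarrow> 'a \<Rightarrow> real) \<Rightarrow> bool" where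
  "gromov_hyperbolic M d \<longleftrightarrow> Metric_space M d \<and>
     (\<exists>\<delta>\<ge>0. \<forall>w\<in>M. \<forall>x\<in>M. \<forall>y\<in>M. \<forall>z\<in>M.
        gromov_product d w x z \<ge> min (gromov_product d w x y) (gromov_product d w y z) - \<delta>)"

text \<open>
  Sequences converging to infinity, and their equivalence; both notions do not depend on the
  base point \<open>w\<close>. A boundary point is an equivalence class of such sequences.
\<close>

definition gromov_sequence :: "'a set \<Rightarrow> ('a \<Rightarrow> 'a \<Rightarrow> real) \<Rightarrow> (nat \<Rightarrow> 'a) \<Rightarrow> bool" where
  "gromov_sequence M d s \<longleftrightarrow> range s \<subseteq> M \<and>
     (\<forall>w\<in>M. filterlim (\<lambda>(i, j). gromov_product d w (s i) (s j)) at_top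
              (sequentially \<times>\<^sub>F sequentially))"

definition gromov_equiv :: "'a set \<Rightarrow> ('a \<Rightarrow> 'a \<Rightarrow> real) \<Rightarrow> (nat \<Rightarrow> 'a) rel" where
  "gromov_equiv M d = {(s, t). gromov_sequence M d s \<and> gromov_sequence M d t \<and>
     (\<forall>w\<in>M. filterlim (\<lambda>(i, j). gromov_product d w (s i) (t j)) at_top
              (sequentially \<times>\<^sub>F sequentially))}"

definition gromov_boundary :: "'a set \<Rightarrow> ('a \<Rightarrow> 'a \<Rightarrow> real) \<Rightarrow> (nat \<Rightarrow> 'a) set set" where
  "gromov_boundary M d = Collect (gromov_sequence M d) // gromov_equiv M d"


section \<open>Isometric actions on hyperbolic spaces\<close>

text \<open>
  In \<open>X \<union> \<partial>X\<close>, a sequence of points of \<open>X\<close> converges to \<open>\<xi> \<in> \<partial>X\<close> iff it is a representative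
  of \<open>\<xi>\<close>. So \<open>\<xi>\<close> is an accumulation point of an orbit iff some representative of \<open>\<xi>\<close> lies in
  that orbit; this does not depend on the orbit.
\<close>

definition limit_set ::
  "'a set \<Rightarrow> ('a \<Rightarrow> 'a \<Rightarrow> real) \<Rightarrow> ('g, 'c) monoid_scheme \<Rightarrow> ('g \<Rightarrow> 'a \<Rightarrow> 'a) \<Rightarrow> (nat \<Rightarrow> 'a) set set"
where
  "limit_set M d G \<phi> =
     {\<xi> \<in> gromov_boundary M d. \<exists>x\<in>M. \<exists>s\<in>\<xi>. range s \<subseteq> orbit G \<phi> x}"

definition elliptic ::
  "'a set \<Rightarrow> ('a \<Rightarrow> 'a \<Rightarrow> real) \<Rightarrow> ('g, 'c) monoid_scheme \<Rightarrow> ('g \<Rightarrow> 'a \<Rightarrow> 'a) \<Rightarrow> 'g \<Rightarrow> bool"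
where
  "elliptic M d G \<phi> g \<longleftrightarrow>
     (\<forall>x\<in>M. Metric_space.mbounded M d (orbit (subgroup_generated G {g}) \<phi> x))"

definition loxodromic ::
  "'a set \<Rightarrow> ('a \<Rightarrow> 'a \<Rightarrow> real) \<Rightarrow> ('g, 'c) monoid_scheme \<Rightarrow> ('g \<Rightarrow> 'a \<Rightarrow> 'a) \<Rightarrow> 'g \<Rightarrow> bool"
where
  "loxodromic M d G \<phi> g \<longleftrightarrow>
     (\<forall>x\<in>M. \<exists>L>0. (\<lambda>n. d (\<phi> (g [^]\<^bsub>G\<^esub> (n::nat)) x) x / real n) \<longlonglongrightarrow> L)"

definition parabolic_action ::
  "'a set \<Rightarrow> ('a \<Rightarrow> 'a \<Rightarrow> real) \<Rightarrow> ('g, 'c) monoid_scheme \<Rightarrow> ('g \<Rightarrow> 'a \<Rightarrow> 'a) \<Rightarrow> bool"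
where
  "parabolic_action M d G \<phi> \<longleftrightarrow> (\<exists>!\<xi>. \<xi> \<in> limit_set M d G \<phi>)"

text \<open>The limit set of a loxodromic element \<open>g\<close> is that of the cyclic subgroup it generates.\<close>

definition general_action ::
  "'a set \<Rightarrow> ('a \<Rightarrow> 'a \<Rightarrow> real) \<Rightarrow> ('g, 'c) monoid_scheme \<Rightarrow> ('g \<Rightarrow> 'a \<Rightarrow> 'a) \<Rightarrow> bool"
where
  "general_action M d G \<phi> \<longleftrightarrow> infinite (limit_set M d G \<phi>) \<and>
     (\<exists>g\<in>carrier G. \<exists>h\<in>carrier G. loxodromic M d G \<phi> g \<and> loxodromic M d G \<phi> h \<and>
        limit_set M d (subgroup_generated G {g}) \<phi> \<inter>
        limit_set M d (subgroup_generated G {h}) \<phi> = {})"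


section \<open>Groups\<close>

definition virtually_cyclic :: "('g, 'c) monoid_scheme \<Rightarrow> bool" where
  "virtually_cyclic G \<longleftrightarrow>
     (\<exists>H. subgroup H G \<and> finite (rcosets\<^bsub>G\<^esub> H) \<and> cyclic_group (G\<lparr>carrier := H\<rparr>))"

definition finitely_generated_group :: "('g, 'c) monoid_scheme \<Rightarrow> bool" where
  "finitely_generated_group G \<longleftrightarrow>
     (\<exists>S. finite S \<and> S \<subseteq> carrier G \<and> generate G S = carrier G)"

definition locally_finite_group :: "('g, 'c) monoid_scheme \<Rightarrow> bool" where
  "locally_finite_group G \<longleftrightarrow>
     (\<forall>H. subgroup H G \<and> finitely_generated_group (G\<lparr>carrier := H\<rparr>) \<longrightarrow> finite H)"


definition exactly_one :: "bool list \<Rightarrow> bool" where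
  "exactly_one Ps \<longleftrightarrow> (\<exists>!i. i < length Ps \<and> Ps ! i)"

end

theory Submission
  imports Defs
begin

text \<open>
  Fix a vertex \<open>x\<close> and pull the metric back to \<open>G\<close> along the orbit map. This is a hyperbolic
  left-invariant premetric whose balls are finite, because some stabiliser is finite and the graph
  is locally finite. The four-point inequality shows that \<open>g\<close> is loxodromic as soon as
  \<open>d x (g\<^sup>2 x) > d x (g x) + 2 \<delta>\<close>, and that the orbit of a loxodromic element is a quasi-line.

  Suppose that there is no loxodromic element. Then points \<open>g x\<close> and \<open>h x\<close> far from \<open>x\<close> have a large
  Gromov product, since otherwise \<open>g h\<close> would be loxodromic. So there is only one limit point.
  Moreover every finite subset of \<open>G\<close> moves some point by at most a constant that does not depend on
  the subset, and by bounded valence this makes finitely generated subgroups finite.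

  Suppose that \<open>g\<close> is loxodromic. By properness, two loxodromic elements with a common limit point
  have a common non-trivial power. If every \<open>h\<close> conjugates some non-trivial power of \<open>g\<close> to a power
  of \<open>g\<close>, then \<open>G x\<close> lies in a neighbourhood of the quasi-line of \<open>g\<close>, whence \<open>\<langle>g\<rangle>\<close> has finite
  index. Otherwise \<open>g\<close> and some conjugate \<open>k = h g h\<^sup>-\<^sup>1\<close> have disjoint limit sets, and the translates
  by powers of \<open>g\<close> of a limit point of \<open>k\<close> are pairwise distinct.
\<close>

section \<open>Hyperbolic premetrics\<close>

text \<open>Distinct points may have distance zero, since the orbit map along which the metric is
  pulled back need not be injective.\<close>

locale hyperbolic_premetric =
  fixes M :: "'a set" and d :: "'a \<Rightarrow> 'a \<Rightarrow> real" and \<delta> :: real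
  assumes self [simp]: "x \<in> M \<Longrightarrow> d x x = 0"
    and commute: "d x y = d y x"
    and nonneg [simp]: "0 \<le> d x y"
    and triangle: "x \<in> M \<Longrightarrow> y \<in> M \<Longrightarrow> z \<in> M \<Longrightarrow> d x z \<le> d x y + d y z"
    and hyperbolic: "w \<in> M \<Longrightarrow> x \<in> M \<Longrightarrow> y \<in> M \<Longrightarrow> z \<in> M \<Longrightarrow>
      gromov_product d w x z \<ge> min (gromov_product d w x y) (gromov_product d w y z) - \<delta>"
    and delta_nonneg: "0 \<le> \<delta>"
begin

abbreviation gp :: "'a \<Rightarrow> 'a \<Rightarrow> 'a \<Rightarrow> real" where
  "gp \<equiv> gromov_product d"

lemma gp_commute: "gp w x y = gp w y x"
  by (simp add: gromov_product_def commute)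

text \<open>Multiplying out the inequality for products removes the base point and leaves a
  symmetric condition on the three ways of pairing four points.\<close>

lemma four_point:
  assumes "x \<in> M" "y \<in> M" "z \<in> M" "w \<in> M"
  shows "d x z + d y w \<le> max (d x y + d z w) (d x w + d y z) + 2 * \<delta>"
  using hyperbolic[of w x y z] assms commute[of w x] commute[of w y] commute[of w z]
  unfolding gromov_product_def min_def max_def by argo

lemma gp_hyperbolic3:
  assumes "w \<in> M" "x \<in> M" "a \<in> M" "b \<in> M" "y \<in> M"
  shows "gp w x y \<ge> min (gp w x a) (min (gp w a b) (gp w b y)) - 2 * \<delta>"
  using hyperbolic[of w x a y] hyperbolic[of w a b y] assms delta_nonneg
  by (simp add: min_def split: if_splits)

lemma gp_le_dist:
  assumes "w \<in> M" "x \<in> M" "y \<in> M" shows "gp w x y \<le> d w x"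
  using triangle[of y x w] assms by (simp add: gromov_product_def commute)

lemma gp_switch: "gp w x y + gp x w y = d w x"
  by (simp add: gromov_product_def commute field_simps)

lemma gp_base_change:
  assumes "w \<in> M" "w' \<in> M" "x \<in> M" "y \<in> M"
  shows "gp w x y \<le> gp w' x y + d w w'"
  using triangle[of x w' w] triangle[of y w' w] assms
  by (simp add: gromov_product_def commute field_simps)

lemma gp_point_change:
  assumes "w \<in> M" "x \<in> M" "x' \<in> M" "y \<in> M"
  shows "gp w x y \<le> gp w x' y + d x x'"
  using triangle[of w x' x] triangle[of x' x y] assms
  by (simp add: gromov_product_def commute field_simps)

text \<open>Switching base points, the products of \<open>a\<close> and of \<open>b\<close> with
  \<open>p\<close> at \<open>q\<close> are at least \<open>d p q - B\<close>; hyperbolicity at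
  \<open>q\<close> bounds the smaller one by \<open>K + \<delta>\<close>.\<close>

lemma dist_le_of_gp:
  assumes "a \<in> M" "b \<in> M" "p \<in> M" "q \<in> M"
    and "gp p a q \<le> B" "gp p q b \<le> B" "gp q a b \<le> K"
  shows "d p q \<le> K + B + \<delta>"
proof -
  have "gp q a p + gp p a q = d p q" "gp q p b + gp p q b = d p q"
    by (simp_all add: gromov_product_def commute field_simps)
  moreover have "gp q a b \<ge> min (gp q a p) (gp q p b) - \<delta>"
    using hyperbolic assms by blast
  ultimately show ?thesis using assms by (simp add: min_def split: if_splits)
qed

text \<open>The point sought is the first \<open>q i\<close> whose product with \<open>q 0\<close>, seen from \<open>p\<close>, is small.\<close>

lemma near_chain:
  fixes q :: "nat \<Rightarrow> 'a"
  assumes "p \<in> M" and q: "\<And>i. q i \<in> M"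
    and K: "\<And>i. i \<le> N \<Longrightarrow> gp (q i) (q 0) (q N) \<le> K"
    and T: "\<And>i. i < N \<Longrightarrow> d (q i) (q (Suc i)) \<le> T"
    and K': "gp p (q 0) (q N) \<le> K'" and "0 \<le> T"
  shows "\<exists>i\<le>N. d p (q i) \<le> K + K' + T + 2 * \<delta>"
proof -
  define j where "j = (LEAST j. gp p (q 0) (q j) \<le> K' + \<delta>)"
  have N: "gp p (q 0) (q N) \<le> K' + \<delta>" using K' delta_nonneg by simp
  have j: "gp p (q 0) (q j) \<le> K' + \<delta>" unfolding j_def by (rule LeastI[of _ N]) (rule N)
  have jN: "j \<le> N" unfolding j_def by (rule Least_le) (rule N)
  have "gp p (q j) (q N) \<le> K' + \<delta> + T"
  proof (cases j)
    case 0
    then show ?thesis using K' delta_nonneg \<open>0 \<le> T\<close> by simp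
  next
    case (Suc i)
    \<comment> \<open>By minimality of \<open>j\<close> the predecessor \<open>i\<close> still has a
      large product with \<open>q 0\<close>, so hyperbolicity makes its product with
      \<open>q N\<close> small; one step of the chain costs \<open>T\<close>.\<close>
    then have "\<not> gp p (q 0) (q i) \<le> K' + \<delta>"
      using not_less_Least[of i "\<lambda>j. gp p (q 0) (q j) \<le> K' + \<delta>"] by (simp add: j_def)
    moreover have "gp p (q 0) (q N) \<ge> min (gp p (q 0) (q i)) (gp p (q i) (q N)) - \<delta>"
      using hyperbolic q \<open>p \<in> M\<close> by blast
    ultimately have "gp p (q i) (q N) \<le> K' + \<delta>" using K' by (simp add: min_def split: if_splits)
    moreover have "gp p (q j) (q N) \<le> gp p (q i) (q N) + d (q j) (q i)"
      using gp_point_change q \<open>p \<in> M\<close> by blast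
    moreover have "d (q j) (q i) \<le> T" using T[of i] Suc jN by (simp add: commute)
    ultimately show ?thesis by simp
  qed
  then have "d p (q j) \<le> K + (K' + \<delta> + T) + \<delta>"
    using j K[OF jN] \<open>0 \<le> T\<close> q \<open>p \<in> M\<close> by (intro dist_le_of_gp[of "q 0" "q N"]) auto
  with jN show ?thesis by (intro exI[of _ j]) simp
qed

end

text \<open>Fekete's lemma: the limit is the infimum of the quotients \<open>a n / real n\<close>
  over positive \<open>n\<close>.\<close>

lemma subadditive_limit:
  fixes a :: "nat \<Rightarrow> real"
  assumes sub: "\<And>m n. a (m + n) \<le> a m + a n" and nonneg: "\<And>n. 0 \<le> a n"
    and lower: "\<And>n. n > 0 \<Longrightarrow> c * real n \<le> a n"
  shows "\<exists>L\<ge>c. (\<lambda>n. a n / real n) \<longlonglongrightarrow> L"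
proof -
  define A where "A = (\<lambda>n. a n / real n) ` {0<..}"
  define L where "L = Inf A"
  have ne: "A \<noteq> {}" by (auto simp: A_def)
  have bdd: "bdd_below A" by (rule bdd_belowI[of _ 0]) (auto simp: A_def nonneg)
  have "c \<le> L" unfolding L_def
    by (rule cInf_greatest[OF ne]) (use lower in \<open>auto simp: A_def field_simps\<close>)
  have mult: "a (m * q + r) \<le> real q * a m + a r" for m q r
  proof (induction q)
    case (Suc q)
    have "a (m * Suc q + r) \<le> a m + a (m * q + r)"
      using sub[of m "m * q + r"] by (simp add: algebra_simps)
    with Suc show ?case by (simp add: algebra_simps)
  qed simp
  have "(\<lambda>n. a n / real n) \<longlonglongrightarrow> L"
  proof (rule LIMSEQ_I)
    fix e :: real assume "e > 0"
    then obtain m where m: "m > 0" "a m / real m < L + e / 2"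
      using cInf_lessD[OF ne, of "L + e/2"] by (auto simp: A_def L_def)
    \<comment> \<open>\<open>C\<close> bounds the contribution of the remainder modulo
      \<open>m\<close>, which becomes negligible after division by \<open>n\<close>.\<close>
    define C where "C = Max (a ` {..<m})"
    have C: "a r \<le> C" if "r < m" for r unfolding C_def using that by (intro Max_ge) auto
    then have "C \<ge> 0" using nonneg[of 0] m by (metis order_trans)
    obtain N where N: "N > 0" "2 * C / e < real N"
      by (metis gr0I of_nat_0 reals_Archimedean2 less_trans not_less_iff_gr_or_eq zero_less_one of_nat_less_0_iff)
    show "\<exists>no. \<forall>n\<ge>no. norm (a n / real n - L) < e"
    proof (intro exI allI impI)
      fix n assume "n \<ge> N"
      then have n: "n > 0" "2 * C / e < real n" using N by auto
      have 1: "L \<le> a n / real n" unfolding L_def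
        by (rule cInf_lower[OF _ bdd]) (use n in \<open>auto simp: A_def\<close>)
      have "a n \<le> real (n div m) * a m + a (n mod m)"
        using mult[of m "n div m" "n mod m"] by simp
      also have "\<dots> \<le> real (n div m) * a m + C" using C m by simp
      also have "real (n div m) * a m \<le> (real n / real m) * a m"
        using of_nat_div_le_of_nat[of n m] nonneg by (intro mult_right_mono) auto
      finally have "a n \<le> real n * (a m / real m) + C" by simp
      also have "\<dots> \<le> real n * (L + e / 2) + C"
        using m by (intro add_right_mono mult_left_mono) auto
      also have "C < real n * (e / 2)" using n \<open>e > 0\<close> by (simp add: field_simps)
      finally have "a n < real n * (L + e)" by (simp add: algebra_simps)
      then have "a n / real n < L + e" using n by (simp add: field_simps)
      with 1 show "norm (a n / real n - L) < e" by simp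
    qed
  qed
  with \<open>c \<le> L\<close> show ?thesis by blast
qed


text \<open>This makes positivity of the translation length invariant under conjugation and under
  change of the base point.\<close>

lemma growth_rate_bounded_change:
  fixes a b :: "nat \<Rightarrow> real"
  assumes "(\<lambda>n. a n / real n) \<longlonglongrightarrow> L" and C: "\<And>n. \<bar>b n - a n\<bar> \<le> C"
  shows "(\<lambda>n. b n / real n) \<longlonglongrightarrow> L"
proof -
  have "(\<lambda>n. (b n - a n) / real n) \<longlonglongrightarrow> 0"
  proof (rule Lim_null_comparison)
    show "\<forall>\<^sub>F n in sequentially. norm ((b n - a n) / real n) \<le> C / real n"
      using C by (intro always_eventually) (simp add: divide_right_mono)
    show "(\<lambda>n. C / real n) \<longlonglongrightarrow> 0" by (rule lim_const_over_n)
  qed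
  from tendsto_add[OF assms(1) this] show ?thesis
    by (simp add: diff_divide_distrib)
qed

section \<open>Groups with a hyperbolic left-invariant premetric\<close>

context group
begin

lemma intertwine_int_pow:
  fixes n :: int
  assumes [simp]: "h \<in> carrier G" "x \<in> carrier G" "y \<in> carrier G" and eq: "h \<otimes> x = y \<otimes> h"
  shows "h \<otimes> x [^] n = y [^] n \<otimes> h"
proof -
  have nat: "h \<otimes> u [^] m = v [^] m \<otimes> h"
    if [simp]: "u \<in> carrier G" "v \<in> carrier G" and "h \<otimes> u = v \<otimes> h" for u v and m :: nat
  proof (induction m)
    case (Suc m)
    have "h \<otimes> u [^] Suc m = v [^] m \<otimes> (h \<otimes> u)"
      using Suc by (simp flip: m_assoc)
    then show ?case using that by (simp add: m_assoc)
  qed simp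
  have "h \<otimes> inv x = inv y \<otimes> (y \<otimes> h) \<otimes> inv x" by (simp flip: m_assoc)
  also have "\<dots> = inv y \<otimes> h" by (simp add: m_assoc flip: eq)
  finally have inv: "h \<otimes> inv x = inv y \<otimes> h" .
  show ?thesis
  proof (cases "n < 0")
    case True
    then show ?thesis
      using nat[OF _ _ inv, of "nat (- n)"] by (simp add: int_pow_neg int_pow_inv)
  next
    case False
    then show ?thesis using nat[OF _ _ eq, of "nat n"] by simp
  qed
qed

text \<open>For \<open>g\<close> of infinite order these are the elements of the commensurator of
  the cyclic group of \<open>g\<close>. The equation avoids inverses and so has the shape required
  by \<open>intertwine_int_pow\<close>.\<close>

definition commensurates :: "'a \<Rightarrow> 'a \<Rightarrow> bool" where
  "commensurates h g \<longleftrightarrow> (\<exists>(a::int) (b::int). a \<noteq> 0 \<and> b \<noteq> 0 \<and> h \<otimes> g [^] a = g [^] b \<otimes> h)"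

lemma commensurates_mult:
  assumes [simp]: "h \<in> carrier G" "h' \<in> carrier G" "g \<in> carrier G"
    and "commensurates h g" "commensurates h' g"
  shows "commensurates (h \<otimes> h') g"
proof -
  obtain a b :: int where ab: "a \<noteq> 0" "b \<noteq> 0" "h \<otimes> g [^] a = g [^] b \<otimes> h"
    using assms by (auto simp: commensurates_def)
  obtain a' b' :: int where ab': "a' \<noteq> 0" "b' \<noteq> 0" "h' \<otimes> g [^] a' = g [^] b' \<otimes> h'"
    using assms by (auto simp: commensurates_def)
  \<comment> \<open>The first relation is raised to \<open>b'\<close> and the second to
    \<open>a\<close>, so that \<open>h\<close> takes over exactly the power to which
    \<open>h'\<close> sends \<open>g [^] (a' * a)\<close>.\<close>
  have 1: "h \<otimes> g [^] (a * b') = g [^] (b * b') \<otimes> h"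
    using intertwine_int_pow[OF _ _ _ ab(3), of b'] by (simp add: int_pow_pow)
  have 2: "h' \<otimes> g [^] (a' * a) = g [^] (b' * a) \<otimes> h'"
    using intertwine_int_pow[OF _ _ _ ab'(3), of a] by (simp add: int_pow_pow)
  have "h \<otimes> h' \<otimes> g [^] (a' * a) = h \<otimes> g [^] (a * b') \<otimes> h'"
    using 2 by (simp add: m_assoc mult.commute)
  also have "\<dots> = g [^] (b * b') \<otimes> (h \<otimes> h')"
    using 1 by (simp add: m_assoc)
  finally show ?thesis
    using ab ab' unfolding commensurates_def by (intro exI[of _ "a' * a"] exI[of _ "b * b'"]) auto
qed

lemma commensurates_one: "g \<in> carrier G \<Longrightarrow> commensurates \<one> g"
  unfolding commensurates_def by (intro exI[of _ 1]) auto

end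

locale hyperbolic_length_group = group G + hyperbolic_premetric "carrier G" D \<delta>
  for G :: "('g, 'c) monoid_scheme" (structure) and D :: "'g \<Rightarrow> 'g \<Rightarrow> real" and \<delta> :: real +
  assumes left_invariant:
    "g \<in> carrier G \<Longrightarrow> x \<in> carrier G \<Longrightarrow> y \<in> carrier G \<Longrightarrow> D (g \<otimes> x) (g \<otimes> y) = D x y"
begin

abbreviation len :: "'g \<Rightarrow> real" where "len \<equiv> D \<one>"

text \<open>Positive stable translation length; for the premetric of an orbit this is being
  loxodromic, by \<open>loxodromic_iff_escapes\<close>.\<close>

definition escaping :: "'g \<Rightarrow> bool" where
  "escaping g \<longleftrightarrow> (\<exists>L>0. (\<lambda>n. len (g [^] (n::nat)) / real n) \<longlonglongrightarrow> L)"

lemma gp_left_invariant: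
  assumes "g \<in> carrier G" "w \<in> carrier G" "x \<in> carrier G" "y \<in> carrier G"
  shows "gp (g \<otimes> w) (g \<otimes> x) (g \<otimes> y) = gp w x y"
  using assms by (simp add: gromov_product_def left_invariant)

lemma D_mult_right [simp]: "g \<in> carrier G \<Longrightarrow> h \<in> carrier G \<Longrightarrow> D h (h \<otimes> g) = len g"
  using left_invariant[of h \<one> g] by simp

lemma D_eq_len: "g \<in> carrier G \<Longrightarrow> h \<in> carrier G \<Longrightarrow> D g h = len (inv g \<otimes> h)"
  using left_invariant[of "inv g" g h] by simp

lemma len_inv [simp]: "g \<in> carrier G \<Longrightarrow> len (inv g) = len g"
  using left_invariant[of g "inv g" \<one>] commute[of "inv g" \<one>] by simp

lemma len_mult_le: "g \<in> carrier G \<Longrightarrow> h \<in> carrier G \<Longrightarrow> len (g \<otimes> h) \<le> len g + len h"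
  using triangle[of \<one> g "g \<otimes> h"] by simp

lemma D_int_pow:
  fixes i j :: int
  shows "g \<in> carrier G \<Longrightarrow> D (g [^] i) (g [^] j) = len (g [^] (j - i))"
  using D_eq_len[of "g [^] i" "g [^] j"] int_pow_mult[of g "- i" j] by (simp add: int_pow_neg)

lemma len_int_pow_minus [simp]: "g \<in> carrier G \<Longrightarrow> len (g [^] (- n :: int)) = len (g [^] n)"
  by (simp add: int_pow_neg)

lemma len_int_pow_abs: "g \<in> carrier G \<Longrightarrow> len (g [^] \<bar>n :: int\<bar>) = len (g [^] n)"
  by (cases "n \<ge> 0") auto

lemma len_nat_pow_le: "g \<in> carrier G \<Longrightarrow> len (g [^] (n::nat)) \<le> real n * len g"
proof (induction n)
  case (Suc n)
  then show ?case using len_mult_le[of "g [^] n" g] by (simp add: algebra_simps)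
qed simp

lemma len_int_pow_le: "g \<in> carrier G \<Longrightarrow> len (g [^] (n::int)) \<le> \<bar>of_int n\<bar> * len g"
  using len_nat_pow_le[of g "nat \<bar>n\<bar>"] len_int_pow_abs[of g n]
    int_pow_int[of G g "nat \<bar>n\<bar>"] by simp

text \<open>The four-point inequality for \<open>\<one>\<close>, \<open>g\<close>,
  \<open>g [^] 2\<close>, \<open>g [^] (n + 2)\<close> leaves two candidates for the maximum. The
  first would make the length drop from exponent \<open>n\<close> to \<open>n + 1\<close>, against
  the induction hypothesis; the second gives the claim.\<close>

lemma len_pow_strict_growth:
  assumes [simp]: "g \<in> carrier G" and e: "len (g \<otimes> g) \<ge> len g + 2 * \<delta> + e" "e > 0"
  shows "len (g [^] n) + e \<le> len (g [^] Suc n)"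
proof (induction n)
  case 0
  then show ?case using len_mult_le[of g g] e delta_nonneg by simp
next
  case (Suc n)
  have p: "g [^] (2::int) = g \<otimes> g" "g [^] int m = g [^] m" for m :: nat
    by (simp_all add: int_pow_def2 numeral_2_eq_2)
  have "len (g [^] (2::int)) + D (g [^] (1::int)) (g [^] int (n + 2))
    \<le> max (len (g [^] (1::int)) + D (g [^] (2::int)) (g [^] int (n + 2)))
          (len (g [^] int (n + 2)) + D (g [^] (1::int)) (g [^] (2::int))) + 2 * \<delta>"
    by (rule four_point) auto
  also have "D (g [^] (1::int)) (g [^] int (n + 2)) = len (g [^] int (Suc n))"
    by (subst D_int_pow) (simp_all add: algebra_simps)
  also have "D (g [^] (2::int)) (g [^] int (n + 2)) = len (g [^] int n)"
    by (subst D_int_pow) (simp_all add: algebra_simps)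
  also have "D (g [^] (1::int)) (g [^] (2::int)) = len g"
    by (subst D_int_pow) simp_all
  finally have "len (g \<otimes> g) + len (g [^] Suc n)
    \<le> max (len g + len (g [^] n)) (len (g [^] Suc (Suc n)) + len g) + 2 * \<delta>"
    by (simp only: p int_pow_1[OF \<open>g \<in> carrier G\<close>] add_2_eq_Suc')
  then show ?case using Suc e by (auto simp: max_def split: if_splits)
qed

lemma escapingI:
  assumes [simp]: "g \<in> carrier G" and gg: "len (g \<otimes> g) > len g + 2 * \<delta>"
  shows "escaping g"
proof -
  define e where "e = len (g \<otimes> g) - len g - 2 * \<delta>"
  have e: "e > 0" "len (g \<otimes> g) \<ge> len g + 2 * \<delta> + e" using gg by (auto simp: e_def)
  have low: "e * real n \<le> len (g [^] n)" for n
  proof (induction n)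
    case (Suc n)
    then show ?case using len_pow_strict_growth[of g e n] e by (simp add: algebra_simps)
  qed simp
  have "\<exists>L\<ge>e. (\<lambda>n. len (g [^] n) / real n) \<longlonglongrightarrow> L"
    by (rule subadditive_limit) (use low in \<open>auto simp flip: nat_pow_mult intro: len_mult_le\<close>)
  with e show ?thesis unfolding escaping_def by (meson less_le_trans)
qed

text \<open>Squaring an element that does not escape adds at most \<open>2 * \<delta>\<close> to its
  length, so \<open>g\<close> and \<open>inv g\<close> run together from \<open>\<one>\<close> for
  about half of their length.\<close>

lemma not_escaping_gp:
  assumes "g \<in> carrier G" "\<not> escaping g"
  shows "gp \<one> g (inv g) \<ge> len g / 2 - \<delta>"
proof -
  have "D g (inv g) = len (g \<otimes> g)"
    using assms D_eq_len[of "inv g" g] commute[of g] by simp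
  then show ?thesis
    using escapingI[of g] assms by (fastforce simp: gromov_product_def commute)
qed

lemma escaping_conj:
  assumes [simp]: "g \<in> carrier G" "h \<in> carrier G" and "escaping g"
  shows "escaping (h \<otimes> g \<otimes> inv h)"
proof -
  have pow: "(h \<otimes> g \<otimes> inv h) [^] n = h \<otimes> g [^] n \<otimes> inv h" for n :: nat
  proof (induction n)
    case (Suc n)
    have "inv h \<otimes> (h \<otimes> (g \<otimes> inv h)) = g \<otimes> inv h" by (simp flip: m_assoc)
    with Suc show ?case by (simp add: m_assoc)
  qed simp
  have "\<bar>len (h \<otimes> g [^] n \<otimes> inv h) - len (g [^] n)\<bar> \<le> 2 * len h" for n :: nat
  proof -
    let ?k = "h \<otimes> g [^] n \<otimes> inv h"
    have "len ?k \<le> len h + len (g [^] n) + len h"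
      using len_mult_le[of "h \<otimes> g [^] n" "inv h"] len_mult_le[of h "g [^] n"] by simp
    moreover have "inv h \<otimes> ?k \<otimes> h = inv h \<otimes> h \<otimes> g [^] n \<otimes> (inv h \<otimes> h)"
      by (simp only: m_assoc m_closed nat_pow_closed inv_closed assms(1,2))
    then have "g [^] n = inv h \<otimes> ?k \<otimes> h" by simp
    then have "len (g [^] n) \<le> len h + len ?k + len h"
      using len_mult_le[of "inv h \<otimes> ?k" "h"] len_mult_le[of "inv h" ?k] by simp
    ultimately show ?thesis by simp
  qed
  note bound = this
  obtain L where "L > 0" "(\<lambda>n. len (g [^] (n::nat)) / real n) \<longlonglongrightarrow> L"
    using assms by (auto simp: escaping_def)
  with growth_rate_bounded_change[OF this(2) bound] show ?thesis
    unfolding escaping_def pow by blast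
qed

lemma escaping_len_large:
  assumes [simp]: "g \<in> carrier G" and "escaping g"
  shows "\<exists>N::nat. \<forall>n::int. int N \<le> \<bar>n\<bar> \<longrightarrow> R \<le> len (g [^] n)"
proof -
  obtain L where L: "L > 0" "(\<lambda>n. len (g [^] (n::nat)) / real n) \<longlonglongrightarrow> L"
    using assms by (auto simp: escaping_def)
  have "filterlim (\<lambda>n. len (g [^] (n::nat)) / real n * real n) at_top sequentially"
    by (rule filterlim_tendsto_pos_mult_at_top[OF L(2,1)]) (rule filterlim_real_sequentially)
  then have "\<forall>\<^sub>F n in sequentially. len (g [^] (n::nat)) / real n * real n \<ge> R"
    by (simp add: filterlim_at_top)
  then obtain N where N: "\<And>n. n \<ge> N \<Longrightarrow> len (g [^] (n::nat)) / real n * real n \<ge> R"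
    by (auto simp: eventually_sequentially)
  have "R \<le> len (g [^] n)" if "int (Suc N) \<le> \<bar>n\<bar>" for n :: int
    using N[of "nat \<bar>n\<bar>"] that len_int_pow_abs[of g n] by (simp flip: int_pow_int)
  then show ?thesis by blast
qed

lemma escaping_int_pow_neq_one:
  assumes "g \<in> carrier G" "escaping g" "(a :: int) \<noteq> 0"
  shows "g [^] a \<noteq> \<one>"
proof
  assume eq: "g [^] a = \<one>"
  obtain N :: nat where N: "\<And>n::int. int N \<le> \<bar>n\<bar> \<Longrightarrow> 1 \<le> len (g [^] n)"
    using escaping_len_large[OF assms(1,2)] by blast
  have "int N \<le> \<bar>a * int N\<bar>" 
    using mult_right_mono[of 1 "\<bar>a\<bar>" "int N"] \<open>a \<noteq> 0\<close> by (simp only: abs_mult) linarith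
  moreover have "g [^] (a * int N) = \<one>"
    using int_pow_pow[OF assms(1), of a "int N"] eq by simp
  ultimately show False using N[of "a * int N"] by simp
qed

text \<open>The difference \<open>len (g\<^sup>2\<^sup>n) - len (g\<^sup>n)\<close> grows linearly in \<open>n\<close>.\<close>

lemma escaping_power_doubling:
  assumes [simp]: "g \<in> carrier G" and "escaping g"
  shows "\<exists>N::nat>0. len (g [^] N \<otimes> g [^] N) \<ge> len (g [^] N) + c"
proof -
  let ?a = "\<lambda>n. len (g [^] (n::nat))"
  obtain L where L: "L > 0" "(\<lambda>n. ?a n / real n) \<longlonglongrightarrow> L"
    using assms by (auto simp: escaping_def)
  have "filterlim (\<lambda>n::nat. 2 * n) at_top sequentially"
    by (rule filterlim_subseq) (auto simp: strict_mono_def)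
  from filterlim_compose[OF L(2) this]
  have "(\<lambda>n. 2 * (?a (2 * n) / real (2 * n)) - ?a n / real n) \<longlonglongrightarrow> 2 * L - L"
    by (intro tendsto_intros L(2))
  then have "(\<lambda>n. (?a (2 * n) - ?a n) / real n) \<longlonglongrightarrow> L"
    by (simp add: diff_divide_distrib)
  from filterlim_tendsto_pos_mult_at_top[OF this L(1) filterlim_real_sequentially]
  have "\<forall>\<^sub>F n in sequentially. (?a (2 * n) - ?a n) / real n * real n \<ge> c"
    by (simp add: filterlim_at_top)
  from eventually_conj[OF this eventually_gt_at_top[of 0]]
  obtain n where "n > 0" "?a (2 * n) - ?a n \<ge> c"
    by (auto dest!: eventually_happens)
  then show ?thesis by (intro exI[of _ n]) (simp add: nat_pow_mult mult_2)
qed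

text \<open>Each further power adds at least \<open>\<delta> + 1\<close> to the length. So, for
  positive \<open>m\<close> and \<open>n\<close>, the products of \<open>f\<close> with
  \<open>f [^] n\<close> and of \<open>inv f\<close> with \<open>f [^] (- m)\<close> exceed that of
  \<open>f\<close> with \<open>inv f\<close> by more than \<open>2 * \<delta>\<close>, and the
  product between the two half-lines must be the small one.\<close>

lemma doubling_gp_bounded:
  assumes [simp]: "f \<in> carrier G" and ff: "len (f \<otimes> f) \<ge> len f + 3 * \<delta> + 1"
  shows "gp \<one> (f [^] (- int m)) (f [^] int n) \<le> len f / 2 + \<delta>"
proof (cases "m = 0 \<or> n = 0")
  case True
  then show ?thesis using delta_nonneg by (auto simp: gromov_product_def commute)
next
  case False
  have grow: "len (f [^] int (k - 1)) + (\<delta> + 1) \<le> len (f [^] int k)" if "k \<noteq> 0" for k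
    using len_pow_strict_growth[of f "\<delta> + 1" "k - 1"] ff that delta_nonneg
    by (simp only: int_pow_int) simp
  have one: "f [^] (- 1 :: int) = inv f" "f [^] (1 :: int) = f" by (simp_all add: int_pow_neg)
  have "D f (f [^] int n) = len (f [^] int (n - 1))"
    using D_int_pow[of f 1 "int n"] False by (simp add: of_nat_diff)
  then have 1: "gp \<one> (f [^] int n) f \<ge> (len f + \<delta> + 1) / 2"
    using grow[of n] False by (simp add: gromov_product_def commute)
  have "D (inv f) (f [^] (- int m)) = len (f [^] (- int (m - 1)))"
    using D_int_pow[of f "-1" "- int m"] False one by (simp add: of_nat_diff)
  then have 2: "gp \<one> (inv f) (f [^] (- int m)) \<ge> (len f + \<delta> + 1) / 2"
    using grow[of m] False by (simp add: gromov_product_def commute)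
  have "D (inv f) f = len (f \<otimes> f)" using D_eq_len[of "inv f" f] by simp
  then have "gp \<one> (inv f) f \<le> len f / 2 - \<delta> - (\<delta> + 1) / 2"
    using ff by (simp add: gromov_product_def commute field_simps)
  moreover have "gp \<one> (inv f) f \<ge> min (gp \<one> (inv f) (f [^] (- int m)))
      (min (gp \<one> (f [^] (- int m)) (f [^] int n)) (gp \<one> (f [^] int n) f)) - 2 * \<delta>"
    by (rule gp_hyperbolic3) auto
  ultimately show ?thesis using 1 2 delta_nonneg unfolding min_def by argo
qed

text \<open>The bound holds for a power \<open>f\<close> of \<open>g\<close> to which
  \<open>doubling_gp_bounded\<close> applies, and carries over because every power of
  \<open>g\<close> is within \<open>real N * len g\<close> of a power of \<open>f\<close>.\<close>

lemma escaping_quasi_line: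
  assumes [simp]: "g \<in> carrier G" and "escaping g"
  obtains K where "\<And>i j l :: int. i \<le> j \<Longrightarrow> j \<le> l \<Longrightarrow> gp (g [^] j) (g [^] i) (g [^] l) \<le> K"
proof -
  obtain N :: nat where N: "N > 0" "len (g [^] N \<otimes> g [^] N) \<ge> len (g [^] N) + (3 * \<delta> + 1)"
    using escaping_power_doubling[OF assms] by blast
  define f where "f = g [^] N"
  have f [simp]: "f \<in> carrier G" by (simp add: f_def)
  have fpow: "f [^] i = g [^] (int N * i)" for i :: int
    by (simp add: f_def int_pow_pow flip: int_pow_int)
  define K where "K = len f / 2 + \<delta> + 2 * (real N * len g)"
  have near: "D (g [^] (s * int m)) (f [^] (s * int (m div N))) \<le> real N * len g"
    if "s = 1 \<or> s = -1" for s :: int and m :: nat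
  proof -
    have "int N * (s * int (m div N)) - s * int m = - (s * int (m mod N))"
      using that by (auto simp: zdiv_int zmod_int minus_mod_eq_mult_div [symmetric])
    then have "D (g [^] (s * int m)) (f [^] (s * int (m div N))) = len (g [^] (s * int (m mod N)))"
      by (simp add: fpow D_int_pow)
    also have "\<dots> \<le> real (m mod N) * len g"
      using len_int_pow_le[of g "s * int (m mod N)"] that by auto
    also have "\<dots> \<le> real N * len g"
      using N by (intro mult_right_mono) (auto intro: less_imp_le)
    finally show ?thesis .
  qed
  have nat: "gp \<one> (g [^] (- int m)) (g [^] int n) \<le> K" for m n
  proof -
    let ?m = "f [^] (- int (m div N))" and ?n = "f [^] int (n div N)"
    have "gp \<one> (g [^] (- int m)) (g [^] int n) \<le> gp \<one> ?m (g [^] int n) + D (g [^] (- int m)) ?m"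
      by (rule gp_point_change) auto
    also have "gp \<one> ?m (g [^] int n) \<le> gp \<one> ?m ?n + D (g [^] int n) ?n"
      using gp_point_change[of \<one> "g [^] int n" ?n ?m] by (simp add: gp_commute)
    also have "gp \<one> ?m ?n \<le> len f / 2 + \<delta>"
      by (rule doubling_gp_bounded) (use N in \<open>auto simp: f_def\<close>)
    finally show ?thesis
      using near[of "-1" m] near[of 1 n] by (simp add: K_def)
  qed
  have "gp (g [^] j) (g [^] i) (g [^] l) \<le> K" if "i \<le> j" "j \<le> l" for i j l :: int
  proof -
    have "gp (g [^] j) (g [^] i) (g [^] l) = gp \<one> (g [^] (i - j)) (g [^] (l - j))"
      using gp_left_invariant[of "g [^] j" \<one> "g [^] (i - j)" "g [^] (l - j)"]
        int_pow_mult[of g j "i - j"] int_pow_mult[of g j "l - j"] by simp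
    then show ?thesis using nat[of "nat (j - i)" "nat (l - j)"] that by simp
  qed
  then show ?thesis by (rule that)
qed

text \<open>Consecutive powers of \<open>k\<close> form a chain with steps of length
  \<open>len k\<close>, to which \<open>near_chain\<close> applies.\<close>

lemma near_cyclic_segment:
  fixes m n :: int
  assumes [simp]: "k \<in> carrier G" "p \<in> carrier G"
    and K: "\<And>i j l :: int. i \<le> j \<Longrightarrow> j \<le> l \<Longrightarrow> gp (k [^] j) (k [^] i) (k [^] l) \<le> K"
    and K': "gp p (k [^] m) (k [^] n) \<le> K'"
  shows "\<exists>j::int. D p (k [^] j) \<le> K + K' + len k + 2 * \<delta>"
proof -
  have *: "\<exists>j::int. D p (k [^] j) \<le> K + K' + len k + 2 * \<delta>"
    if "m \<le> n" "gp p (k [^] m) (k [^] n) \<le> K'" for m n :: int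
  proof -
    define q where "q = (\<lambda>i::nat. k [^] (m + int i))"
    have "\<exists>i\<le>nat (n - m). D p (q i) \<le> K + K' + len k + 2 * \<delta>"
    proof (rule near_chain)
      show "gp (q i) (q 0) (q (nat (n - m))) \<le> K" if "i \<le> nat (n - m)" for i
        using K[of m "m + int i" "m + int (nat (n - m))"] that \<open>m \<le> n\<close> by (simp add: q_def)
      show "D (q i) (q (Suc i)) \<le> len k" for i
        by (simp add: q_def D_int_pow)
      show "gp p (q 0) (q (nat (n - m))) \<le> K'"
        using that by (simp add: q_def)
    qed (auto simp: q_def)
    then show ?thesis by (auto simp: q_def)
  qed
  show ?thesis
    using *[of m n] *[of n m] K' gp_commute[of p "k [^] m" "k [^] n"] by (cases "m \<le> n") auto
qed

text \<open>The elements \<open>h k\<^sup>a\<^sup>n\<close> and \<open>k\<^sup>b\<^sup>n\<close> stay at bounded distance from each other, so \<open>h\<close> sees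
  \<open>k\<^sup>b\<^sup>n\<close> and \<open>k\<^sup>-\<^sup>b\<^sup>n\<close> in nearly the same way as it sees \<open>h k\<^sup>a\<^sup>n\<close> and \<open>h k\<^sup>-\<^sup>a\<^sup>n\<close>.\<close>

lemma commensurating_near_cyclic:
  assumes [simp]: "k \<in> carrier G" and "escaping k"
  shows "\<exists>R. \<forall>h\<in>carrier G. commensurates h k \<longrightarrow> (\<exists>j::int. D h (k [^] j) \<le> R)"
proof -
  obtain K where K: "\<And>i j l :: int. i \<le> j \<Longrightarrow> j \<le> l \<Longrightarrow> gp (k [^] j) (k [^] i) (k [^] l) \<le> K"
    using escaping_quasi_line[OF assms] by blast
  have K1: "gp \<one> (k [^] i) (k [^] (- i)) \<le> K" for i :: int
  proof (cases "0 \<le> i")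
    case True
    then show ?thesis using K[of "- i" 0 i] by (simp add: gp_commute[of _ "k [^] i"])
  next
    case False
    then show ?thesis using K[of i 0 "- i"] by simp
  qed
  show ?thesis
  proof (intro exI[of _ "K + (K + 2 * \<delta>) + len k + 2 * \<delta>"] ballI impI)
    fix h assume h [simp]: "h \<in> carrier G" and "commensurates h k"
    then obtain a b :: int where ab: "a \<noteq> 0" "b \<noteq> 0" and eq: "h \<otimes> k [^] a = k [^] b \<otimes> h"
      by (auto simp: commensurates_def)
    \<comment> \<open>\<open>N\<close> depends on \<open>h\<close>: it pushes \<open>k [^] c\<close>
      and \<open>k [^] (- c)\<close> so far out that \<open>len h\<close> does not matter. The final
      bound does not depend on \<open>N\<close>.\<close>
    obtain N where N: "\<And>n::int. int N \<le> \<bar>n\<bar> \<Longrightarrow> K + 2 * \<delta> + 2 * len h + 1 \<le> len (k [^] n)"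
      using escaping_len_large[OF assms] by blast
    define c where "c = b * int N"
    have eqs: "h \<otimes> k [^] (a * int N) = k [^] c \<otimes> h" "h \<otimes> k [^] (- (a * int N)) = k [^] (- c) \<otimes> h"
      using intertwine_int_pow[OF _ _ _ eq, of "int N"] intertwine_int_pow[OF _ _ _ eq, of "- int N"]
      by (simp_all add: c_def int_pow_pow)
    have "int N \<le> \<bar>c\<bar>"
      using mult_right_mono[of 1 "\<bar>b\<bar>" "int N"] ab unfolding c_def by (simp only: abs_mult) linarith
    then have len: "K + 2 * \<delta> + 2 * len h + 1 \<le> len (k [^] c)" by (rule N)
    have far: "gp h (u \<otimes> h) u \<ge> len u - 2 * len h" if [simp]: "u \<in> carrier G" for u
    proof -
      have "len u \<le> len h + D h u" "len u \<le> len h + D h (u \<otimes> h) + len h"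
        using triangle[of \<one> h u] triangle[of h "u \<otimes> h" u]
        by (simp_all add: commute[of _ u])
      then show ?thesis by (simp add: gromov_product_def commute field_simps)
    qed
    have "gp h (k [^] c \<otimes> h) (k [^] (- c) \<otimes> h) = gp (h \<otimes> \<one>) (h \<otimes> k [^] (a * int N)) (h \<otimes> k [^] (- (a * int N)))"
      by (simp add: eqs)
    also have "\<dots> \<le> K" using K1 by (subst gp_left_invariant) auto
    finally have "gp h (k [^] c \<otimes> h) (k [^] (- c) \<otimes> h) \<le> K" .
    moreover have "gp h (k [^] c \<otimes> h) (k [^] (- c) \<otimes> h) \<ge> min (gp h (k [^] c \<otimes> h) (k [^] c))
       (min (gp h (k [^] c) (k [^] (- c))) (gp h (k [^] (- c)) (k [^] (- c) \<otimes> h))) - 2 * \<delta>"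
      by (rule gp_hyperbolic3) auto
    moreover have "gp h (k [^] c \<otimes> h) (k [^] c) \<ge> K + 2 * \<delta> + 1"
      using far[of "k [^] c"] len by simp
    moreover have "gp h (k [^] (- c)) (k [^] (- c) \<otimes> h) \<ge> K + 2 * \<delta> + 1"
      using far[of "k [^] (- c)"] len by (simp add: gp_commute[of h "k [^] (- c)"])
    ultimately have "gp h (k [^] c) (k [^] (- c)) \<le> K + 2 * \<delta>"
      by (simp add: min_def split: if_splits)
    from near_cyclic_segment[OF _ _ K this]
    show "\<exists>j::int. D h (k [^] j) \<le> K + (K + 2 * \<delta>) + len k + 2 * \<delta>" by simp
  qed
qed

text \<open>Suppose that the product is at most \<open>c\<close>. As neither \<open>g\<close> nor
  \<open>h\<close> escapes, each runs along its inverse, so \<open>inv g\<close> and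
  \<open>h\<close> separate early too and \<open>f = g \<otimes> h\<close> is long. Then
  \<open>f\<close> starts along \<open>g\<close>, \<open>inv f\<close> along \<open>inv h\<close>,
  and \<open>f\<close> along \<open>inv f\<close>, since \<open>f\<close> does not escape; so
  \<open>g\<close> would start along \<open>inv h\<close>, which it does not.\<close>

lemma not_escaping_pair_gp:
  assumes none: "\<And>f. f \<in> carrier G \<Longrightarrow> \<not> escaping f"
    and [simp]: "g \<in> carrier G" "h \<in> carrier G"
    and c: "c \<ge> 0" and len: "len g > 2 * c + 5 * \<delta>" "len h > 2 * c + 5 * \<delta>"
  shows "gp \<one> g h > c"
proof (rule ccontr)
  assume "\<not> gp \<one> g h > c"
  then have gh: "gp \<one> g h \<le> c" by simp
  note ne = not_escaping_gp[OF _ none]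
  have 1: "gp \<one> (inv g) h \<le> c + \<delta>"
    using hyperbolic[of \<one> g "inv g" h] gh ne[of g] len delta_nonneg
    by (simp add: min_def split: if_splits)
  have 2: "gp \<one> g (inv h) \<le> c + \<delta>"
    using hyperbolic[of \<one> g "inv h" h] gh ne[of h] len delta_nonneg gp_commute[of \<one> h "inv h"]
    by (simp add: min_def split: if_splits)
  define f where "f = g \<otimes> h"
  have f [simp]: "f \<in> carrier G" by (simp add: f_def)
  have lenf: "len f = len g + len h - 2 * gp \<one> (inv g) h"
    using D_eq_len[of "inv g" h] by (simp add: f_def gromov_product_def commute field_simps)
  have "D f g = len h" using D_mult_right[of h g] by (simp add: f_def commute)
  then have "gp \<one> g f = (len g + len f - len h) / 2"
    by (simp add: gromov_product_def commute)
  then have 3: "gp \<one> g f \<ge> len g - c - \<delta>"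
    using 1 lenf by simp
  have "D (inv f) (inv h) = len g"
    using D_mult_right[of "inv g" "inv h"] by (simp add: f_def inv_mult_group commute)
  then have "gp \<one> (inv f) (inv h) = (len f + len h - len g) / 2"
    using len_inv[of f] len_inv[of h] by (simp add: gromov_product_def commute)
  then have 4: "gp \<one> (inv f) (inv h) \<ge> len h - c - \<delta>"
    using 1 lenf by simp
  have "gp \<one> g (inv h) \<ge> min (gp \<one> g f) (min (gp \<one> f (inv f)) (gp \<one> (inv f) (inv h))) - 2 * \<delta>"
    by (rule gp_hyperbolic3) auto
  then have "gp \<one> f (inv f) \<le> c + 3 * \<delta>"
    using 2 3 4 len c delta_nonneg by (simp add: min_def split: if_splits)
  moreover have "gp \<one> f (inv f) \<ge> len f / 2 - \<delta>" using ne[of f] f by simp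
  \<comment> \<open>The lengths give \<open>len f > 2 * c + 8 * \<delta>\<close>; the summands
    \<open>5 * \<delta>\<close> in the hypotheses are chosen for this.\<close>
  ultimately show False using 1 lenf len delta_nonneg by argo
qed

text \<open>For \<open>i \<le> j\<close> the point \<open>g [^] (a * i)\<close> lies between
  \<open>\<one>\<close> and \<open>g [^] (a * j)\<close> on the quasi-line, so the product is at
  least \<open>len (g [^] (a * i))\<close> minus a constant. The sign of \<open>a\<close> selects
  the end of the line.\<close>

lemma escaping_pow_gp_large:
  assumes [simp]: "g \<in> carrier G" and "escaping g" "(a::int) \<noteq> 0"
  shows "\<exists>N. \<forall>i\<ge>N. \<forall>j\<ge>N. R \<le> gp \<one> (g [^] (a * int i)) (g [^] (a * int j))"
proof -
  obtain K where K: "\<And>i j l :: int. i \<le> j \<Longrightarrow> j \<le> l \<Longrightarrow> gp (g [^] j) (g [^] i) (g [^] l) \<le> K"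
    using escaping_quasi_line[OF assms(1,2)] by blast
  obtain N where N: "\<And>n::int. int N \<le> \<bar>n\<bar> \<Longrightarrow> R + K \<le> len (g [^] n)"
    using escaping_len_large[OF assms(1,2)] by blast
  have ordered: "R \<le> gp \<one> (g [^] (a * int i)) (g [^] (a * int j))" if "N \<le> i" "i \<le> j" for i j
  proof -
    have "gp (g [^] (a * int i)) \<one> (g [^] (a * int j)) \<le> K"
    proof (cases "a > 0")
      case True
      then show ?thesis using K[of 0 "a * int i" "a * int j"] that by simp
    next
      case False
      then show ?thesis
        using K[of "a * int j" "a * int i" 0] that
        by (simp add: gp_commute[of _ \<one>] mult_left_mono_neg mult_nonpos_nonneg)
    qed
    moreover have "int N \<le> \<bar>a * int i\<bar>"
      using mult_right_mono[of 1 "\<bar>a\<bar>" "int i"] that assms(3) by (simp only: abs_mult) linarith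
    ultimately show ?thesis
      using N[of "a * int i"] gp_switch[of \<one> "g [^] (a * int i)" "g [^] (a * int j)"] by simp
  qed
  have "R \<le> gp \<one> (g [^] (a * int i)) (g [^] (a * int j))" if "N \<le> i" "N \<le> j" for i j
    using ordered[of i j] ordered[of j i] that gp_commute by (cases "i \<le> j") auto
  then show ?thesis by blast
qed

end

section \<open>Proper premetrics and commensurable elements\<close>

locale proper_length_group = hyperbolic_length_group +
  assumes proper: "finite {g \<in> carrier G. len g \<le> r}"
begin

text \<open>Pigeonhole: the quotients \<open>f j\<close> of \<open>g [^] j\<close> by a nearby power
  of \<open>k\<close> lie in a finite ball. A coincidence \<open>f i = f j\<close> equates a power
  of \<open>g\<close> with one of \<open>k\<close>, whose exponent is non-zero because
  \<open>g\<close> has infinite order.\<close>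

lemma commensurable_if_near:
  fixes J :: "int set"
  assumes [simp]: "g \<in> carrier G" "k \<in> carrier G" and "escaping g" and J: "infinite J"
    and near: "\<And>j. j \<in> J \<Longrightarrow> \<exists>m::int. D (g [^] j) (k [^] m) \<le> R"
  shows "\<exists>(a::int) (b::int). a \<noteq> 0 \<and> b \<noteq> 0 \<and> g [^] a = k [^] b"
proof -
  obtain m :: "int \<Rightarrow> int" where m: "\<And>j. j \<in> J \<Longrightarrow> D (g [^] j) (k [^] m j) \<le> R"
    using near by metis
  define f where "f = (\<lambda>j. inv (k [^] m j) \<otimes> g [^] j)"
  have "f ` J \<subseteq> {g \<in> carrier G. len g \<le> R}"
    using m D_eq_len[of "k [^] m j" "g [^] j" for j] by (auto simp: f_def commute)
  then have "finite (f ` J)" using proper finite_subset by blast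
  then have "\<not> inj_on f J" using J finite_imageD by blast
  then obtain i j where ij: "i \<in> J" "j \<in> J" "i \<noteq> j" "f i = f j" by (auto simp: inj_on_def)
  have "g [^] i \<otimes> g [^] (- j) = k [^] m i \<otimes> f i \<otimes> g [^] (- j)"
    by (simp add: f_def flip: m_assoc)
  also have "\<dots> = k [^] m i \<otimes> inv (k [^] m j)"
    unfolding ij(4) by (simp add: f_def m_assoc int_pow_neg)
  finally have eq: "g [^] (i - j) = k [^] (m i - m j)"
    using int_pow_mult[of g i "- j"] int_pow_mult[of k "m i" "- m j"] by (simp add: int_pow_neg)
  have "m i - m j \<noteq> 0"
    using escaping_int_pow_neq_one[of g "i - j"] \<open>escaping g\<close> ij eq by force
  with eq ij show ?thesis by (intro exI[of _ "i - j"] exI[of _ "m i - m j"]) simp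
qed

text \<open>Unbounded Gromov products force the two quasi-lines to stay close over longer and longer
  initial segments, hence to meet infinitely often up to a bounded error.\<close>

lemma commensurable_if_gp_unbounded:
  assumes [simp]: "g \<in> carrier G" "k \<in> carrier G" and "escaping g" "escaping k"
    and unb: "\<And>R. \<exists>(n::int) (m::int). gp \<one> (g [^] n) (k [^] m) \<ge> R"
  shows "\<exists>(a::int) (b::int). a \<noteq> 0 \<and> b \<noteq> 0 \<and> g [^] a = k [^] b"
proof -
  obtain K1 where K1: "\<And>i j l :: int. i \<le> j \<Longrightarrow> j \<le> l \<Longrightarrow> gp (g [^] j) (g [^] i) (g [^] l) \<le> K1"
    using escaping_quasi_line[of g] assms by auto
  obtain K2 where K2: "\<And>i j l :: int. i \<le> j \<Longrightarrow> j \<le> l \<Longrightarrow> gp (k [^] j) (k [^] i) (k [^] l) \<le> K2"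
    using escaping_quasi_line[of k] assms by auto
  define R where "R = K2 + (K1 + \<delta>) + len k + 2 * \<delta>"
  define J where "J = {j::int. \<exists>m::int. D (g [^] j) (k [^] m) \<le> R}"
  have ex: "\<exists>j\<in>J. \<bar>j\<bar> = int N" for N
  proof -
    \<comment> \<open>The product is at most \<open>\<bar>n\<bar> * len g\<close>, so this threshold
      forces \<open>N < \<bar>n\<bar>\<close>; below, \<open>j\<close> is the exponent of absolute
      value \<open>N\<close> on the side of \<open>n\<close>.\<close>
    obtain n m :: int where nm: "gp \<one> (g [^] n) (k [^] m) \<ge> real N * len g + 1"
      using unb by blast
    have "gp \<one> (g [^] n) (k [^] m) \<le> len (g [^] n)" by (rule gp_le_dist) auto
    also have "\<dots> \<le> \<bar>of_int n\<bar> * len g" by (rule len_int_pow_le) simp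
    finally have "real N * len g < \<bar>of_int n\<bar> * len g" using nm by simp
    then have "real N < \<bar>of_int n\<bar>" by (rule mult_right_less_imp_less) simp
    then have n: "int N < \<bar>n\<bar>" by linarith
    define j where "j = (if 0 \<le> n then int N else - int N)"
    have "gp (g [^] j) \<one> (g [^] n) \<le> K1"
    proof (cases "0 \<le> n")
      case True
      then show ?thesis using K1[of 0 j n] n by (simp add: j_def)
    next
      case False
      then show ?thesis using K1[of n j 0] n by (simp add: j_def gp_commute[of _ \<one>])
    qed
    then have 1: "gp \<one> (g [^] j) (g [^] n) \<ge> len (g [^] j) - K1"
      using gp_switch[of \<one> "g [^] j" "g [^] n"] by simp
    have "\<bar>j\<bar> = int N" by (simp add: j_def)
    then have "len (g [^] j) \<le> real N * len g"
      using len_int_pow_le[of g j] by (metis \<open>g \<in> carrier G\<close> of_int_abs of_int_of_nat_eq)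
    moreover have "0 \<le> K1" using K1[of 0 0 0] by (simp add: gromov_product_def)
    \<comment> \<open>From \<open>\<one>\<close>, the point \<open>g [^] j\<close> follows
      \<open>g [^] n\<close> for almost its whole length, and \<open>g [^] n\<close> follows
      \<open>k [^] m\<close> at least that long.\<close>
    ultimately have "gp \<one> (g [^] j) (k [^] m) \<ge> len (g [^] j) - K1 - \<delta>"
      using hyperbolic[of \<one> "g [^] j" "g [^] n" "k [^] m"] 1 nm
      by (simp add: min_def split: if_splits)
    then have "gp (g [^] j) (k [^] (0::int)) (k [^] m) \<le> K1 + \<delta>"
      using gp_switch[of \<one> "g [^] j" "k [^] m"] by simp
    from near_cyclic_segment[OF _ _ K2 this] have "j \<in> J" by (auto simp: J_def R_def)
    with \<open>\<bar>j\<bar> = int N\<close> show ?thesis by blast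
  qed
  have "infinite J"
  proof
    assume "finite J"
    then have "finite ((\<lambda>j. nat \<bar>j\<bar>) ` J)" by simp
    moreover have "(\<lambda>j. nat \<bar>j\<bar>) ` J = UNIV"
    proof (intro equalityI subsetI UNIV_I)
      fix N show "N \<in> (\<lambda>j. nat \<bar>j\<bar>) ` J" using ex[of N] by (metis image_eqI nat_int)
    qed
    ultimately show False by simp
  qed
  then show ?thesis
    using assms(1-3) by (intro commensurable_if_near[of g k J R]) (simp_all add: J_def)
qed

text \<open>Every element is a power of \<open>g\<close> times an element of the ball of radius
  \<open>R\<close>, and this finite ball meets all right cosets of the cyclic group.\<close>

lemma virtually_cyclic_if_commensurating:
  assumes [simp]: "g \<in> carrier G" and "escaping g"
    and "\<And>h. h \<in> carrier G \<Longrightarrow> commensurates h g"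
  shows "virtually_cyclic G"
proof -
  obtain R where R: "\<And>h. h \<in> carrier G \<Longrightarrow> \<exists>j::int. D h (g [^] j) \<le> R"
    using commensurating_near_cyclic[of g] assms by blast
  define H where "H = generate G {g}"
  have H: "subgroup H G" unfolding H_def by (rule generate_is_subgroup) simp
  have Hpow: "H = range (\<lambda>n::int. g [^] n)"
    unfolding H_def using generate_pow[of g] by auto
  have "rcosets H \<subseteq> (\<lambda>x. H #> x) ` {x \<in> carrier G. len x \<le> R}"
  proof
    fix C assume "C \<in> rcosets H"
    then obtain h where h: "h \<in> carrier G" "C = H #> h" by (auto simp: RCOSETS_def)
    obtain j :: int where j: "D h (g [^] j) \<le> R" using R h by blast
    let ?x = "inv (g [^] j) \<otimes> h"
    have x: "?x \<in> carrier G" "len ?x \<le> R"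
      using j h D_eq_len[of "g [^] j" h] by (simp_all add: commute)
    have "inv (g [^] j) \<in> H" using Hpow int_pow_neg[of g j] by (metis \<open>g \<in> carrier G\<close> rangeI)
    then have "H #> ?x = C"
      using h H by (metis coset_mult_assoc inv_closed int_pow_closed \<open>g \<in> carrier G\<close>
          subgroup.subset coset_join2)
    then show "C \<in> (\<lambda>x. H #> x) ` {x \<in> carrier G. len x \<le> R}" using x by blast
  qed
  then have "finite (rcosets H)" using proper[of R] by (meson finite_imageI finite_subset)
  moreover have "cyclic_group (G\<lparr>carrier := H\<rparr>)"
    using cyclic_group_generated[of g] by (simp add: subgroup_generated_def H_def)
  ultimately show ?thesis using H unfolding virtually_cyclic_def by blast
qed

text \<open>All \<open>g [^] (r * n)\<close> commensurate \<open>k\<close> as well, so infinitely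
  many powers of \<open>g\<close> lie within a fixed distance of the quasi-line of
  \<open>k\<close>.\<close>

lemma commensurable_if_commensurates_pow:
  assumes [simp]: "g \<in> carrier G" "k \<in> carrier G" and "escaping g" "escaping k"
    and r: "r > 0" "commensurates (g [^] (r::nat)) k"
  shows "\<exists>(a::int) (b::int). a \<noteq> 0 \<and> b \<noteq> 0 \<and> g [^] a = k [^] b"
proof -
  obtain R where R: "\<And>h. h \<in> carrier G \<Longrightarrow> commensurates h k \<Longrightarrow> \<exists>j::int. D h (k [^] j) \<le> R"
    using commensurating_near_cyclic[of k] assms by blast
  have "commensurates (g [^] (r * n)) k" for n
  proof (induction n)
    case (Suc n)
    have "g [^] (r * Suc n) = g [^] r \<otimes> g [^] (r * n)" by (simp add: nat_pow_mult)
    then show ?case using commensurates_mult[OF _ _ _ r(2) Suc] by simp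
  qed (simp add: commensurates_one)
  then have "\<exists>m::int. D (g [^] j) (k [^] m) \<le> R" if "j \<in> range (\<lambda>n. int (r * n))" for j
    using that R by (auto simp only: int_pow_int nat_pow_closed \<open>g \<in> carrier G\<close>)
  moreover have "infinite (range (\<lambda>n. int (r * n)))"
    using r by (intro range_inj_infinite) (auto simp: inj_on_def)
  ultimately show ?thesis using commensurable_if_near[of g k _ R] assms by blast
qed

end

section \<open>Sequences converging to the Gromov boundary\<close>

context hyperbolic_premetric
begin

text \<open>The limit along the product filter, with one threshold for both indices and at a single
  base point; \<open>diverging_base_change\<close> shows that one base point decides for
  all.\<close>

definition diverging :: "'a \<Rightarrow> (nat \<Rightarrow> 'a) \<Rightarrow> (nat \<Rightarrow> 'a) \<Rightarrow> bool" where
  "diverging w s t \<longleftrightarrow> (\<forall>R. \<exists>N. \<forall>i\<ge>N. \<forall>j\<ge>N. R \<le> gp w (s i) (t j))"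

lemma divergingD:
  assumes "diverging w s t"
  obtains N where "\<And>i j. i \<ge> N \<Longrightarrow> j \<ge> N \<Longrightarrow> R \<le> gp w (s i) (t j)"
  using assms unfolding diverging_def by blast

lemma diverging_base_change:
  assumes "w \<in> M" "w' \<in> M" "range s \<subseteq> M" "range t \<subseteq> M" "diverging w s t"
  shows "diverging w' s t"
  unfolding diverging_def
proof
  fix R
  obtain N where N: "\<And>i j. i \<ge> N \<Longrightarrow> j \<ge> N \<Longrightarrow> R + d w w' \<le> gp w (s i) (t j)"
    using divergingD[OF assms(5)] by blast
  have "R \<le> gp w' (s i) (t j)" if "i \<ge> N" "j \<ge> N" for i j
    using N[OF that] gp_base_change[of w w' "s i" "t j"] assms by fastforce
  then show "\<exists>N. \<forall>i\<ge>N. \<forall>j\<ge>N. R \<le> gp w' (s i) (t j)" by blast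
qed

lemma diverging_iff_filterlim:
  assumes "w \<in> M" "range s \<subseteq> M" "range t \<subseteq> M"
  shows "(\<forall>w\<in>M. filterlim (\<lambda>(i, j). gp w (s i) (t j)) at_top (sequentially \<times>\<^sub>F sequentially))
    \<longleftrightarrow> diverging w s t"
proof -
  have "filterlim (\<lambda>(i, j). gp w (s i) (t j)) at_top (sequentially \<times>\<^sub>F sequentially)
      \<longleftrightarrow> diverging w s t" for w
  proof -
    have "(\<exists>N. \<forall>j\<ge>N. \<forall>i\<ge>N. R \<le> gp w (s i) (t j)) \<longleftrightarrow> (\<exists>N. \<forall>i\<ge>N. \<forall>j\<ge>N. R \<le> gp w (s i) (t j))" for R
      by blast
    then show ?thesis
      unfolding filterlim_at_top eventually_prod_sequentially diverging_def by simp
  qed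
  then show ?thesis using diverging_base_change assms by blast
qed

lemma gromov_sequence_iff:
  "w \<in> M \<Longrightarrow> gromov_sequence M d s \<longleftrightarrow> range s \<subseteq> M \<and> diverging w s s"
  using diverging_iff_filterlim[of w s s] unfolding gromov_sequence_def by blast

lemma gromov_equiv_iff:
  "w \<in> M \<Longrightarrow> (s, t) \<in> gromov_equiv M d \<longleftrightarrow>
     gromov_sequence M d s \<and> gromov_sequence M d t \<and> diverging w s t"
  using diverging_iff_filterlim[of w s t] unfolding gromov_equiv_def gromov_sequence_def by blast

lemma equiv_gromov_equiv:
  assumes w: "w \<in> M"
  shows "equiv (Collect (gromov_sequence M d)) (gromov_equiv M d)"
proof (rule equivI)
  show "gromov_equiv M d \<subseteq> Collect (gromov_sequence M d) \<times> Collect (gromov_sequence M d)"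
    by (auto simp: gromov_equiv_def)
  show "refl_on (Collect (gromov_sequence M d)) (gromov_equiv M d)"
    by (auto simp: refl_on_def gromov_equiv_iff[OF w] gromov_sequence_iff[OF w])
  show "sym (gromov_equiv M d)"
    unfolding sym_def gromov_equiv_iff[OF w] diverging_def using gp_commute by metis
  show "trans (gromov_equiv M d)"
  proof (rule transI)
    fix s t u assume st: "(s, t) \<in> gromov_equiv M d" and tu: "(t, u) \<in> gromov_equiv M d"
    then have seq: "gromov_sequence M d s" "gromov_sequence M d t" "gromov_sequence M d u"
      by (auto simp: gromov_equiv_def)
    then have M: "s i \<in> M" "t i \<in> M" "u i \<in> M" for i
      by (auto simp: gromov_sequence_def)
    have "diverging w s u"
      unfolding diverging_def
    proof
      fix R
      obtain N where N: "\<And>i j. i \<ge> N \<Longrightarrow> j \<ge> N \<Longrightarrow> R + \<delta> \<le> gp w (s i) (t j)"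
        using divergingD st w gromov_equiv_iff by metis
      obtain N' where N': "\<And>i j. i \<ge> N' \<Longrightarrow> j \<ge> N' \<Longrightarrow> R + \<delta> \<le> gp w (t i) (u j)"
        using divergingD tu w gromov_equiv_iff by metis
      have "R \<le> gp w (s i) (u j)" if "i \<ge> max N N'" "j \<ge> max N N'" for i j
        using N[of i i] N'[of i j] that hyperbolic[OF w M(1)[of i] M(2)[of i] M(3)[of j]]
        by (simp add: min_def split: if_splits)
      then show "\<exists>N. \<forall>i\<ge>N. \<forall>j\<ge>N. R \<le> gp w (s i) (u j)" by blast
    qed
    then show "(s, u) \<in> gromov_equiv M d" using seq by (simp add: gromov_equiv_iff[OF w])
  qed
qed

lemma diverging_self_dist:
  assumes "w \<in> M" "gromov_sequence M d s"
  obtains N where "\<And>i. i \<ge> N \<Longrightarrow> R \<le> d w (s i)"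
proof -
  have "diverging w s s" "range s \<subseteq> M" using assms gromov_sequence_iff by blast+
  then obtain N where "\<And>i. i \<ge> N \<Longrightarrow> R \<le> gp w (s i) (s i)"
    using divergingD[of w s s R] by metis
  moreover have "gp w (s i) (s i) = d w (s i)" for i
    using \<open>range s \<subseteq> M\<close> by (simp add: gromov_product_def commute range_subsetD)
  ultimately show ?thesis using that[of N] by simp
qed

end

section \<open>Proper isometric actions on hyperbolic spaces\<close>

locale proper_hyperbolic_action = group_action G V \<phi> + hyperbolic_premetric V d \<delta>
  for G :: "('g, 'c) monoid_scheme" (structure) and V :: "'v set"
    and \<phi> :: "'g \<Rightarrow> 'v \<Rightarrow> 'v" and d :: "'v \<Rightarrow> 'v \<Rightarrow> real" and \<delta> :: real +
  assumes metric: "Metric_space V d"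
    and isometric: "g \<in> carrier G \<Longrightarrow> x \<in> V \<Longrightarrow> y \<in> V \<Longrightarrow> d (\<phi> g x) (\<phi> g y) = d x y"
    and proper: "x \<in> V \<Longrightarrow> finite {g \<in> carrier G. d x (\<phi> g x) \<le> r}"
    and nonempty: "V \<noteq> {}"
begin

sublocale group G
  using group_hom by (simp add: group_hom_def)

definition orbit_dist :: "'v \<Rightarrow> 'g \<Rightarrow> 'g \<Rightarrow> real" where
  "orbit_dist x g h = d (\<phi> g x) (\<phi> h x)"

lemma act_closed [simp]: "g \<in> carrier G \<Longrightarrow> x \<in> V \<Longrightarrow> \<phi> g x \<in> V"
  using element_image by blast

lemma act_one [simp]: "x \<in> V \<Longrightarrow> \<phi> \<one> x = x"
  by (metis id_eq_one restrict_apply)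

lemma act_mult: "x \<in> V \<Longrightarrow> g \<in> carrier G \<Longrightarrow> h \<in> carrier G \<Longrightarrow> \<phi> (g \<otimes> h) x = \<phi> g (\<phi> h x)"
  by (rule composition_rule)

lemma gp_orbit_dist: "gromov_product (orbit_dist x) w g h = gp (\<phi> w x) (\<phi> g x) (\<phi> h x)"
  by (simp add: gromov_product_def orbit_dist_def)

lemma orbit_dist_one: "x \<in> V \<Longrightarrow> orbit_dist x \<one> g = d x (\<phi> g x)"
  by (simp add: orbit_dist_def)

lemma proper_length_group: "x \<in> V \<Longrightarrow> proper_length_group G (orbit_dist x) \<delta>"
proof unfold_locales
  assume x: "x \<in> V"
  show "finite {g \<in> carrier G. orbit_dist x \<one> g \<le> r}" for r
    using proper x by (simp add: orbit_dist_one)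
  show "min (gromov_product (orbit_dist x) w a b) (gromov_product (orbit_dist x) w b c) - \<delta>
      \<le> gromov_product (orbit_dist x) w a c"
    if "w \<in> carrier G" "a \<in> carrier G" "b \<in> carrier G" "c \<in> carrier G" for w a b c
    unfolding gp_orbit_dist using that x by (intro hyperbolic) auto
qed (auto simp: orbit_dist_def commute triangle delta_nonneg act_mult isometric)

abbreviation escapes :: "'v \<Rightarrow> 'g \<Rightarrow> bool" where
  "escapes x \<equiv> hyperbolic_length_group.escaping G (orbit_dist x)"

text \<open>An isometry displaces two points by amounts that differ by at most twice their distance,
  so a single orbit decides.\<close>

lemma loxodromic_iff_escapes:
  assumes x: "x \<in> V" and g: "g \<in> carrier G"
  shows "loxodromic V d G \<phi> g \<longleftrightarrow> escapes x g"
proof -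
  interpret X: proper_length_group G "orbit_dist x" \<delta> by (rule proper_length_group[OF x])
  have X: "escapes x g \<longleftrightarrow> (\<exists>L>0. (\<lambda>n. d (\<phi> (g [^] (n::nat)) x) x / real n) \<longlonglongrightarrow> L)"
    unfolding X.escaping_def using x by (simp add: orbit_dist_one commute)
  have "(\<lambda>n. d (\<phi> (g [^] (n::nat)) y) y / real n) \<longlonglongrightarrow> L"
    if y: "y \<in> V" and L: "(\<lambda>n. d (\<phi> (g [^] (n::nat)) x) x / real n) \<longlonglongrightarrow> L" for y L
  proof (rule growth_rate_bounded_change[OF L])
    fix n :: nat
    let ?h = "g [^] n"
    have h: "?h \<in> carrier G" using g by simp
    have "d (\<phi> ?h y) y \<le> d (\<phi> ?h y) (\<phi> ?h x) + d (\<phi> ?h x) x + d x y"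
      using triangle[of "\<phi> ?h y" "\<phi> ?h x" y] triangle[of "\<phi> ?h x" x y] x y h by simp
    moreover have "d (\<phi> ?h x) x \<le> d (\<phi> ?h x) (\<phi> ?h y) + d (\<phi> ?h y) y + d y x"
      using triangle[of "\<phi> ?h x" "\<phi> ?h y" x] triangle[of "\<phi> ?h y" y x] x y h by simp
    ultimately show "\<bar>d (\<phi> ?h y) y - d (\<phi> ?h x) x\<bar> \<le> 2 * d x y"
      using isometric[OF h x y] isometric[OF h y x] commute[of x y] by simp
  qed
  then show ?thesis unfolding X loxodromic_def using x by blast
qed

lemma class_in_limit_set:
  assumes "gromov_sequence V d s" "x \<in> V" "range s \<subseteq> orbit H \<phi> x"
  shows "gromov_equiv V d `` {s} \<in> limit_set V d H \<phi>"
proof -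
  note eq = equiv_gromov_equiv[OF \<open>x \<in> V\<close>]
  have "s \<in> gromov_equiv V d `` {s}"
    using equiv_class_self[OF eq] assms by simp
  moreover have "gromov_equiv V d `` {s} \<in> gromov_boundary V d"
    unfolding gromov_boundary_def using assms by (intro quotientI) simp
  ultimately show ?thesis unfolding limit_set_def using assms by blast
qed

lemma orbit_cyclic:
  assumes "g \<in> carrier G"
  shows "orbit (subgroup_generated G {g}) \<phi> x = range (\<lambda>n::int. \<phi> (g [^] n) x)"
  unfolding orbit_def carrier_subgroup_generated_by_singleton[OF assms] by auto

lemma limit_set_elem_equiv:
  assumes "\<xi> \<in> limit_set V d H \<phi>" "s \<in> \<xi>" "t \<in> \<xi>"
  shows "(s, t) \<in> gromov_equiv V d"
proof -
  obtain w where "w \<in> V" using nonempty by blast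
  then show ?thesis
    using in_quotient_imp_in_rel[OF equiv_gromov_equiv, of w \<xi> s t] assms
    by (auto simp: limit_set_def gromov_boundary_def)
qed

text \<open>Representatives of a common limit point have unbounded mutual products. They may run in
  the orbits of different points \<open>x\<close> and \<open>y\<close>; moving one of them to the
  orbit of \<open>x\<close> costs only \<open>d x y\<close>.\<close>

lemma commensurable_if_limit_sets_meet:
  assumes g: "g \<in> carrier G" "loxodromic V d G \<phi> g"
    and k: "k \<in> carrier G" "loxodromic V d G \<phi> k"
    and "limit_set V d (subgroup_generated G {g}) \<phi> \<inter>
         limit_set V d (subgroup_generated G {k}) \<phi> \<noteq> {}"
  shows "\<exists>(a::int) (b::int). a \<noteq> 0 \<and> b \<noteq> 0 \<and> g [^] a = k [^] b"
proof -
  obtain \<xi> where \<xi>: "\<xi> \<in> limit_set V d (subgroup_generated G {g}) \<phi>"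
    "\<xi> \<in> limit_set V d (subgroup_generated G {k}) \<phi>" using assms by blast
  obtain x s where x: "x \<in> V" "s \<in> \<xi>" "range s \<subseteq> range (\<lambda>n::int. \<phi> (g [^] n) x)"
    using \<xi>(1) orbit_cyclic[OF g(1)] by (auto simp: limit_set_def)
  obtain y t where y: "y \<in> V" "t \<in> \<xi>" "range t \<subseteq> range (\<lambda>n::int. \<phi> (k [^] n) y)"
    using \<xi>(2) orbit_cyclic[OF k(1)] by (auto simp: limit_set_def)
  have st: "diverging x s t"
    using limit_set_elem_equiv[OF \<xi>(1) x(2) y(2)] gromov_equiv_iff x by blast
  interpret X: proper_length_group G "orbit_dist x" \<delta> by (rule proper_length_group[OF x(1)])
  show ?thesis
  proof (rule X.commensurable_if_gp_unbounded)
    show "escapes x g" "escapes x k" using g k x loxodromic_iff_escapes by auto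
    fix R
    obtain N where N: "R + d x y \<le> gp x (s N) (t N)" using divergingD[OF st] by blast
    obtain n :: int where n: "s N = \<phi> (g [^] n) x" using x(3) by blast
    obtain m :: int where m: "t N = \<phi> (k [^] m) y" using y(3) by blast
    have "gp x (\<phi> (k [^] m) y) (s N) \<le> gp x (\<phi> (k [^] m) x) (s N) + d (\<phi> (k [^] m) y) (\<phi> (k [^] m) x)"
      using gp_point_change x y n g k by simp
    also have "d (\<phi> (k [^] m) y) (\<phi> (k [^] m) x) = d x y"
      using isometric k x y by (simp add: commute)
    finally have "R \<le> gp x (\<phi> (g [^] n) x) (\<phi> (k [^] m) x)"
      using N n m by (simp add: gp_commute)
    then have "R \<le> gromov_product (orbit_dist x) \<one> (g [^] n) (k [^] m)"
      using x by (simp add: gp_orbit_dist)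
    then show "\<exists>(n::int) (m::int). R \<le> gromov_product (orbit_dist x) \<one> (g [^] n) (k [^] m)" by blast
  qed (use g k in auto)
qed

lemma loxodromic_pow_gromov_sequence:
  assumes g: "g \<in> carrier G" "loxodromic V d G \<phi> g" and x: "x \<in> V" and h: "h \<in> carrier G"
    and a: "(a::int) \<noteq> 0"
  shows "gromov_sequence V d (\<lambda>n. \<phi> (h \<otimes> g [^] (a * int n)) x)"
proof -
  interpret X: proper_length_group G "orbit_dist x" \<delta> by (rule proper_length_group[OF x(1)])
  have esc: "escapes x g" using g x loxodromic_iff_escapes by blast
  have gp: "gp (\<phi> h x) (\<phi> (h \<otimes> u) x) (\<phi> (h \<otimes> v) x) = gromov_product (orbit_dist x) \<one> u v"
    if "u \<in> carrier G" "v \<in> carrier G" for u v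
    using X.gp_left_invariant[of h \<one> u v] that h by (simp add: gp_orbit_dist)
  have "diverging (\<phi> h x) (\<lambda>n. \<phi> (h \<otimes> g [^] (a * int n)) x) (\<lambda>n. \<phi> (h \<otimes> g [^] (a * int n)) x)"
    unfolding diverging_def using X.escaping_pow_gp_large[OF g(1) esc a] g by (simp add: gp)
  then show ?thesis using gromov_sequence_iff[of "\<phi> h x"] g x h by auto
qed

text \<open>The points \<open>\<phi> (g [^] (a * n)) x\<close> converge to infinity and belong to
  both cyclic orbits.\<close>

lemma limit_sets_meet_if_commensurable:
  assumes g: "g \<in> carrier G" "loxodromic V d G \<phi> g" and k: "k \<in> carrier G"
    and eq: "(a::int) \<noteq> 0" "g [^] a = k [^] (b::int)"
  shows "limit_set V d (subgroup_generated G {g}) \<phi> \<inter>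
         limit_set V d (subgroup_generated G {k}) \<phi> \<noteq> {}"
proof -
  obtain x where x: "x \<in> V" using nonempty by blast
  define s where "s = (\<lambda>n. \<phi> (g [^] (a * int n)) x)"
  have seq: "gromov_sequence V d s"
    using loxodromic_pow_gromov_sequence[OF g x one_closed eq(1)] g by (simp add: s_def)
  have "g [^] (a * int n) = k [^] (b * int n)" for n
    using eq g k by (metis int_pow_pow)
  then have "range s \<subseteq> orbit (subgroup_generated G {k}) \<phi> x"
    unfolding orbit_cyclic[OF k] s_def by auto
  moreover have "range s \<subseteq> orbit (subgroup_generated G {g}) \<phi> x"
    unfolding orbit_cyclic[OF g(1)] s_def by auto
  ultimately show ?thesis using class_in_limit_set[OF seq x] by blast
qed

lemma loxodromic_int_pow_neq_one:
  assumes "g \<in> carrier G" "loxodromic V d G \<phi> g" "(a::int) \<noteq> 0"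
  shows "g [^] a \<noteq> \<one>"
proof -
  obtain x where x: "x \<in> V" using nonempty by blast
  interpret X: proper_length_group G "orbit_dist x" \<delta> by (rule proper_length_group[OF x(1)])
  show ?thesis using X.escaping_int_pow_neq_one assms x loxodromic_iff_escapes by blast
qed

lemma loxodromic_conj:
  assumes "g \<in> carrier G" "h \<in> carrier G" "loxodromic V d G \<phi> g"
  shows "loxodromic V d G \<phi> (h \<otimes> g \<otimes> inv h)"
proof -
  obtain x where x: "x \<in> V" using nonempty by blast
  interpret X: proper_length_group G "orbit_dist x" \<delta> by (rule proper_length_group[OF x(1)])
  show ?thesis
    using X.escaping_conj[of g h] assms loxodromic_iff_escapes[OF x] by simp
qed

lemma loxodromic_not_elliptic:
  assumes g: "g \<in> carrier G" "loxodromic V d G \<phi> g"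
  shows "\<not> elliptic V d G \<phi> g"
proof
  assume ell: "elliptic V d G \<phi> g"
  obtain x where x: "x \<in> V" using nonempty by blast
  interpret X: proper_length_group G "orbit_dist x" \<delta> by (rule proper_length_group[OF x(1)])
  obtain B where B: "\<And>y z. y \<in> orbit (subgroup_generated G {g}) \<phi> x \<Longrightarrow>
      z \<in> orbit (subgroup_generated G {g}) \<phi> x \<Longrightarrow> d y z \<le> B"
    using ell x Metric_space.mbounded_alt[OF metric] unfolding elliptic_def by metis
  have mem: "\<phi> (g [^] n) x \<in> orbit (subgroup_generated G {g}) \<phi> x" for n :: int
    using orbit_cyclic g by auto
  obtain N where "\<And>n::int. int N \<le> \<bar>n\<bar> \<Longrightarrow> B + 1 \<le> orbit_dist x \<one> (g [^] n)"
    using X.escaping_len_large[of g "B + 1"] g x loxodromic_iff_escapes by blast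
  from this[of "int N"] have "B + 1 \<le> d x (\<phi> (g [^] int N) x)" using x by (simp add: orbit_dist_one)
  moreover have "d x (\<phi> (g [^] int N) x) \<le> B" using B[OF mem[of 0] mem[of "int N"]] x by simp
  ultimately show False by simp
qed

lemma infinite_if_loxodromic:
  assumes g: "g \<in> carrier G" "loxodromic V d G \<phi> g"
  shows "infinite (carrier G)"
proof
  assume "finite (carrier G)"
  then have "g [^] int (order G) = \<one>" "int (order G) \<noteq> 0"
    using pow_order_eq_1[OF g(1)] order_gt_0_iff_finite by (auto simp: int_pow_int)
  then show False using loxodromic_int_pow_neq_one[OF g] by blast
qed

lemma elliptic_if_finite_order:
  assumes g: "g \<in> carrier G" and fin: "finite (carrier (subgroup_generated G {g}))"
  shows "elliptic V d G \<phi> g"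
  unfolding elliptic_def
proof
  fix x assume x: "x \<in> V"
  have "orbit (subgroup_generated G {g}) \<phi> x = (\<lambda>h. \<phi> h x) ` carrier (subgroup_generated G {g})"
    by (auto simp: orbit_def)
  then have "finite (orbit (subgroup_generated G {g}) \<phi> x)" using fin by simp
  moreover have "orbit (subgroup_generated G {g}) \<phi> x \<subseteq> V"
    using orbit_cyclic[OF g] g x by auto
  ultimately show "Metric_space.mbounded V d (orbit (subgroup_generated G {g}) \<phi> x)"
    using x Max_ge[OF finite_imageI] unfolding Metric_space.mbounded[OF metric] by blast
qed

text \<open>Each loxodromic element has a non-trivial power in the cyclic subgroup \<open>H\<close>
  of finite index. Hence any two of them have a common non-trivial power, and their limit sets
  meet.\<close>

lemma not_virtually_cyclic_if_general:
  assumes "general_action V d G \<phi>"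
  shows "\<not> virtually_cyclic G"
proof
  assume "virtually_cyclic G"
  then obtain H where H: "subgroup H G" "finite (rcosets H)" and cyc: "cyclic_group (G\<lparr>carrier := H\<rparr>)"
    by (auto simp: virtually_cyclic_def)
  have "group (G\<lparr>carrier := H\<rparr>)" by (rule subgroup_imp_group[OF H(1)])
  from cyc[unfolded group.cyclic_group[OF this]]
  obtain z where z: "z \<in> H" "H = range (\<lambda>n::int. z [^]\<^bsub>G\<lparr>carrier := H\<rparr>\<^esub> n)" by auto
  then have Hz: "H = range (\<lambda>n::int. z [^] n)"
    using int_pow_consistent[OF H(1) z(1)] by simp
  have HG: "H \<subseteq> carrier G" by (rule subgroup.subset[OF H(1)])
  then have zG [simp]: "z \<in> carrier G" using z by blast
  have pow: "\<exists>(p::int) (a::int). p \<noteq> 0 \<and> a \<noteq> 0 \<and> g [^] p = z [^] a"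
    if g [simp]: "g \<in> carrier G" and lox: "loxodromic V d G \<phi> g" for g
  proof -
    \<comment> \<open>Pigeonhole on the finitely many cosets of \<open>H\<close>: two different
      powers of \<open>g\<close> lie in the same one.\<close>
    have "range (\<lambda>n::nat. H #> g [^] n) \<subseteq> rcosets H"
      using HG by (auto intro: rcosetsI)
    then have "\<not> inj (\<lambda>n::nat. H #> g [^] n)"
      using H(2) finite_subset infinite_UNIV_nat finite_imageD by metis
    then obtain i j :: nat where ij: "i \<noteq> j" "H #> g [^] i = H #> g [^] j" by (auto simp: inj_def)
    then have "g [^] i \<in> H #> g [^] j" using rcos_self[of "g [^] i" H] H by simp
    then obtain h where h: "h \<in> H" "g [^] i = h \<otimes> g [^] j" by (auto simp: r_coset_def)
    have hG: "h \<in> carrier G" using h HG by blast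
    obtain a :: int where a: "h = z [^] a" using Hz h by blast
    have "g [^] (int i - int j) = h \<otimes> (g [^] j \<otimes> inv (g [^] j))"
      using h hG by (simp add: int_pow_diff int_pow_int m_assoc)
    then have eq: "g [^] (int i - int j) = z [^] a" using hG a by simp
    have ne: "int i - int j \<noteq> 0" using ij by simp
    have "a \<noteq> 0" using loxodromic_int_pow_neq_one[OF g lox ne] eq by auto
    with eq ne show ?thesis by blast
  qed
  obtain g h where gh: "g \<in> carrier G" "h \<in> carrier G" "loxodromic V d G \<phi> g" "loxodromic V d G \<phi> h"
    and disj: "limit_set V d (subgroup_generated G {g}) \<phi> \<inter>
        limit_set V d (subgroup_generated G {h}) \<phi> = {}"
    using assms by (auto simp: general_action_def)
  obtain p a :: int where pa: "p \<noteq> 0" "a \<noteq> 0" "g [^] p = z [^] a" using pow gh by blast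
  obtain q b :: int where qb: "q \<noteq> 0" "b \<noteq> 0" "h [^] q = z [^] b" using pow gh by blast
  have "g [^] (p * b) = z [^] (a * b)" using pa gh by (simp flip: int_pow_pow)
  also have "\<dots> = h [^] (q * a)" using qb gh by (simp add: mult.commute[of a] flip: int_pow_pow)
  finally have "g [^] (p * b) = h [^] (q * a)" .
  moreover have "p * b \<noteq> 0" using pa qb by simp
  ultimately show False using limit_sets_meet_if_commensurable gh disj by blast
qed

lemma general_if_not_commensurates:
  assumes g: "g \<in> carrier G" "loxodromic V d G \<phi> g"
    and h: "h \<in> carrier G" "\<not> commensurates h g"
  shows "general_action V d G \<phi>"
proof -
  define k where "k = h \<otimes> g \<otimes> inv h"
  have k: "k \<in> carrier G" "loxodromic V d G \<phi> k"
    using g h loxodromic_conj by (auto simp: k_def)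
  have hk: "h \<otimes> g [^] b = k [^] b \<otimes> h" for b :: int
    using g h k by (intro intertwine_int_pow) (auto simp: k_def m_assoc)
  \<comment> \<open>A common power of \<open>g\<close> and its conjugate \<open>k\<close> would mean
    that \<open>h\<close> commensurates \<open>g\<close>.\<close>
  have incomm: "\<not> (\<exists>(a::int) (b::int). a \<noteq> 0 \<and> b \<noteq> 0 \<and> g [^] a = k [^] b)"
  proof clarify
    fix a b :: int assume "a \<noteq> 0" "b \<noteq> 0" and "g [^] a = k [^] b"
    then have "h \<otimes> g [^] b = g [^] a \<otimes> h" using hk by simp
    then show False using h \<open>a \<noteq> 0\<close> \<open>b \<noteq> 0\<close> unfolding commensurates_def by blast
  qed
  have disj: "limit_set V d (subgroup_generated G {g}) \<phi> \<inter>
        limit_set V d (subgroup_generated G {k}) \<phi> = {}"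
    using commensurable_if_limit_sets_meet[OF g k] incomm by blast
  obtain x where x: "x \<in> V" using nonempty by blast
  interpret X: proper_length_group G "orbit_dist x" \<delta> by (rule proper_length_group[OF x(1)])
  have esc: "escapes x g" "escapes x k" using g k loxodromic_iff_escapes x by auto
  define s where "s = (\<lambda>n i. \<phi> (g [^] (n::nat) \<otimes> k [^] int i) x)"
  \<comment> \<open>\<open>\<xi> n\<close> is the translate by \<open>g [^] n\<close> of the
    attracting limit point of \<open>k\<close>.\<close>
  define \<xi> where "\<xi> = (\<lambda>n. gromov_equiv V d `` {s n})"
  have seq: "gromov_sequence V d (s n)" for n
    using loxodromic_pow_gromov_sequence[OF k x, of "g [^] n" 1] g by (simp add: s_def)
  have lim: "\<xi> n \<in> limit_set V d G \<phi>" for n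
    unfolding \<xi>_def using g k by (intro class_in_limit_set[OF seq x]) (auto simp: s_def orbit_def)
  \<comment> \<open>If two translates agree, then \<open>k\<close> and its conjugate
    \<open>k'\<close> by \<open>g [^] (n - m)\<close> have the same attracting point and are
    commensurable. So this power of \<open>g\<close> commensurates \<open>k\<close>, which makes
    \<open>g\<close> and \<open>k\<close> commensurable, against \<open>incomm\<close>.\<close>
  have ne: "\<xi> m \<noteq> \<xi> n" if "m < n" for m n
  proof
    assume "\<xi> m = \<xi> n"
    then have "(s m, s n) \<in> gromov_equiv V d"
      unfolding \<xi>_def using eq_equiv_class[OF _ equiv_gromov_equiv[OF x]] seq by blast
    then have div: "diverging (\<phi> (g [^] m) x) (s m) (s n)"
      using gromov_equiv_iff[of "\<phi> (g [^] m) x"] g x by simp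
    define r where "r = n - m"
    define u where "u = g [^] r"
    have r: "r > 0" "n = m + r" using that by (simp_all add: r_def)
    have u: "u \<in> carrier G" using g by (simp add: u_def)
    define k' where "k' = u \<otimes> k \<otimes> inv u"
    have k': "k' \<in> carrier G" "loxodromic V d G \<phi> k'"
      using u k loxodromic_conj by (auto simp: k'_def)
    have uk: "u \<otimes> k [^] b = k' [^] b \<otimes> u" for b :: int
      using u k k' by (intro intertwine_int_pow) (auto simp: k'_def m_assoc)
    have "\<exists>(a::int) (b::int). a \<noteq> 0 \<and> b \<noteq> 0 \<and> k [^] a = k' [^] b"
    proof (rule X.commensurable_if_gp_unbounded)
      show "escapes x k" "escapes x k'" using k k' loxodromic_iff_escapes x by auto
      fix R
      \<comment> \<open>The surplus \<open>orbit_dist x \<one> u\<close> pays for dropping the right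
        factor \<open>u\<close> below.\<close>
      obtain N where "R + orbit_dist x \<one> u \<le> gp (\<phi> (g [^] m) x) (s m N) (s n N)"
        using divergingD[OF div] by blast
      also have "\<dots> = gromov_product (orbit_dist x) (g [^] m \<otimes> \<one>) (g [^] m \<otimes> k [^] int N)
          (g [^] m \<otimes> (u \<otimes> k [^] int N))"
        using g k u by (simp add: gp_orbit_dist s_def r(2) u_def m_assoc flip: nat_pow_mult)
      also have "\<dots> = gromov_product (orbit_dist x) \<one> (k' [^] int N \<otimes> u) (k [^] int N)"
        unfolding uk[symmetric] using g k u
        by (subst X.gp_left_invariant) (auto simp: X.gp_commute)
      also have "\<dots> \<le> gromov_product (orbit_dist x) \<one> (k' [^] int N) (k [^] int N)
          + orbit_dist x (k' [^] int N \<otimes> u) (k' [^] int N)"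
        using g k u k' by (intro X.gp_point_change) auto
      also have "orbit_dist x (k' [^] int N \<otimes> u) (k' [^] int N) = orbit_dist x \<one> u"
        using k' u X.commute by simp
      finally have "R \<le> gromov_product (orbit_dist x) \<one> (k [^] int N) (k' [^] int N)"
        by (simp add: X.gp_commute)
      then show "\<exists>(n::int) (m::int). R \<le> gromov_product (orbit_dist x) \<one> (k [^] n) (k' [^] m)"
        by blast
    qed (use k k' in auto)
    then obtain a b :: int where ab: "a \<noteq> 0" "b \<noteq> 0" "k [^] a = k' [^] b" by blast
    then have "u \<otimes> k [^] b = k [^] a \<otimes> u" using uk by simp
    then have "commensurates (g [^] r) k" using ab unfolding commensurates_def u_def by blast
    then show False
      using X.commensurable_if_commensurates_pow[OF g(1) k(1) esc r(1)] incomm by blast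
  qed
  then have "inj \<xi>" by (metis injI linorder_neqE_nat)
  then have "infinite (range \<xi>)" by (rule range_inj_infinite)
  then have "infinite (limit_set V d G \<phi>)"
    by (rule infinite_super[rotated]) (use lim in auto)
  with disj show ?thesis
    unfolding general_action_def using g k by (intro conjI bexI[of _ g] bexI[of _ k]) auto
qed

lemma loxodromic_dichotomy:
  assumes g: "g \<in> carrier G" "loxodromic V d G \<phi> g"
  shows "virtually_cyclic G \<or> general_action V d G \<phi>"
proof -
  obtain x where x: "x \<in> V" using nonempty by blast
  interpret X: proper_length_group G "orbit_dist x" \<delta> by (rule proper_length_group[OF x(1)])
  show ?thesis
    using X.virtually_cyclic_if_commensurating[of g] general_if_not_commensurates[OF g]
      g loxodromic_iff_escapes[OF x] by blast
qed

lemma gp_large_if_no_loxodromic: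
  assumes none: "\<And>g. g \<in> carrier G \<Longrightarrow> \<not> loxodromic V d G \<phi> g"
    and "x \<in> V" "g \<in> carrier G" "h \<in> carrier G" "0 \<le> c"
    and "d x (\<phi> g x) > 2 * c + 5 * \<delta>" "d x (\<phi> h x) > 2 * c + 5 * \<delta>"
  shows "c < gp x (\<phi> g x) (\<phi> h x)"
proof -
  interpret X: proper_length_group G "orbit_dist x" \<delta> by (rule proper_length_group[OF \<open>x \<in> V\<close>])
  show ?thesis
    using X.not_escaping_pair_gp[of g h c] assms loxodromic_iff_escapes
    by (simp add: gp_orbit_dist orbit_dist_one)
qed

text \<open>Far orbit points have large products. Properness supplies points arbitrarily far away
  and hence a limit point; the same estimate makes any two sequences in orbits that tend to infinity
  equivalent.\<close>

lemma parabolic_if_no_loxodromic: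
  assumes none: "\<And>g. g \<in> carrier G \<Longrightarrow> \<not> loxodromic V d G \<phi> g" and inf: "infinite (carrier G)"
  shows "parabolic_action V d G \<phi>"
proof -
  note large = gp_large_if_no_loxodromic[OF none]
  obtain x where x: "x \<in> V" using nonempty by blast
  have "\<exists>g\<in>carrier G. d x (\<phi> g x) > r" for r
  proof (rule ccontr)
    assume "\<not> (\<exists>g\<in>carrier G. d x (\<phi> g x) > r)"
    then have "{g \<in> carrier G. d x (\<phi> g x) \<le> r} = carrier G" by force
    then show False using proper[OF x, of r] inf by simp
  qed
  then have "\<forall>n::nat. \<exists>g\<in>carrier G. d x (\<phi> g x) > real n" by blast
  then obtain g where g: "\<And>n::nat. g n \<in> carrier G" "\<And>n. d x (\<phi> (g n) x) > real n"
    by metis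
  define s where "s = (\<lambda>n. \<phi> (g n) x)"
  have "diverging x s s"
    unfolding diverging_def
  proof
    fix R
    define N where "N = nat \<lceil>2 * \<bar>R\<bar> + 5 * \<delta>\<rceil>"
    have "R \<le> gp x (s i) (s j)" if "N \<le> i" "N \<le> j" for i j
    proof -
      have "2 * \<bar>R\<bar> + 5 * \<delta> \<le> real N" by (simp add: N_def real_nat_ceiling_ge)
      then have "2 * \<bar>R\<bar> + 5 * \<delta> < d x (\<phi> (g i) x)" "2 * \<bar>R\<bar> + 5 * \<delta> < d x (\<phi> (g j) x)"
        using g(2)[of i] g(2)[of j] that by linarith+
      then have "\<bar>R\<bar> < gp x (s i) (s j)"
        unfolding s_def by (intro large x g) auto
      then show ?thesis by simp
    qed
    then show "\<exists>N. \<forall>i\<ge>N. \<forall>j\<ge>N. R \<le> gp x (s i) (s j)" by blast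
  qed
  then have seq: "gromov_sequence V d s"
    using gromov_sequence_iff[OF x] g x by (auto simp: s_def)
  have "range s \<subseteq> orbit G \<phi> x" using g by (auto simp: s_def orbit_def)
  from class_in_limit_set[OF seq x this] have ex: "gromov_equiv V d `` {s} \<in> limit_set V d G \<phi>" .
  have "\<xi> = \<eta>" if \<xi>: "\<xi> \<in> limit_set V d G \<phi>" and \<eta>: "\<eta> \<in> limit_set V d G \<phi>" for \<xi> \<eta>
  proof -
    obtain x s where x: "x \<in> V" "s \<in> \<xi>" "range s \<subseteq> orbit G \<phi> x"
      using \<xi> by (auto simp: limit_set_def)
    obtain y t where y: "y \<in> V" "t \<in> \<eta>" "range t \<subseteq> orbit G \<phi> y"
      using \<eta> by (auto simp: limit_set_def)
    have seq: "gromov_sequence V d s" "gromov_sequence V d t"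
      using limit_set_elem_equiv[OF \<xi> x(2) x(2)] limit_set_elem_equiv[OF \<eta> y(2) y(2)]
      by (auto simp: gromov_equiv_def)
    have "\<exists>g\<in>carrier G. s n = \<phi> g x" for n using x(3) by (auto simp: orbit_def)
    then obtain g where g: "\<And>n. g n \<in> carrier G" "\<And>n. s n = \<phi> (g n) x" by metis
    have "\<exists>h\<in>carrier G. t n = \<phi> h y" for n using y(3) by (auto simp: orbit_def)
    then obtain h where h: "\<And>n. h n \<in> carrier G" "\<And>n. t n = \<phi> (h n) y" by metis
    have hxy: "d (\<phi> (h n) x) (t n) = d x y" for n using isometric h x y by simp
    have "diverging x s t"
      unfolding diverging_def
    proof
      fix R
      define c where "c = \<bar>R + d x y\<bar>"
      obtain N where N: "\<And>i. N \<le> i \<Longrightarrow> 2 * c + 5 * \<delta> + 1 \<le> d x (s i)"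
        using diverging_self_dist[OF x(1) seq(1)] by blast
      \<comment> \<open>The extra \<open>d x y\<close> allows \<open>t i\<close>, in the orbit of
        \<open>y\<close>, to be replaced by \<open>\<phi> (h i) x\<close>.\<close>
      obtain N' where N': "\<And>i. N' \<le> i \<Longrightarrow> 2 * c + 5 * \<delta> + d x y + 1 \<le> d x (t i)"
        using diverging_self_dist[OF x(1) seq(2)] by blast
      have "R \<le> gp x (s i) (t j)" if "max N N' \<le> i" "max N N' \<le> j" for i j
      proof -
        have "d x (t j) \<le> d x (\<phi> (h j) x) + d x y"
          using triangle[of x "\<phi> (h j) x" "t j"] hxy[of j] h x y by simp
        then have "c < gp x (\<phi> (g i) x) (\<phi> (h j) x)"
          using N[of i] N'[of j] that x g h by (intro large) (auto simp: c_def)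
        moreover have "gp x (\<phi> (h j) x) (s i) \<le> gp x (t j) (s i) + d x y"
          using gp_point_change[of x "\<phi> (h j) x" "t j" "s i"] hxy[of j] x y g h by simp
        ultimately show ?thesis using g by (simp add: c_def gp_commute)
      qed
      then show "\<exists>N. \<forall>i\<ge>N. \<forall>j\<ge>N. R \<le> gp x (s i) (t j)" by blast
    qed
    then have "(s, t) \<in> gromov_equiv V d" using gromov_equiv_iff[OF x(1)] seq by blast
    moreover have "\<xi> \<in> Collect (gromov_sequence V d) // gromov_equiv V d"
      "\<eta> \<in> Collect (gromov_sequence V d) // gromov_equiv V d"
      using \<xi> \<eta> by (auto simp: limit_set_def gromov_boundary_def)
    ultimately show ?thesis
      using quotient_eqI[OF equiv_gromov_equiv[OF x(1)]] x y by blast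
  qed
  with ex show ?thesis unfolding parabolic_action_def by blast
qed

end

lemma exactly_one_of_four:
  assumes "p \<or> q \<or> r \<or> s" "\<not> (p \<and> q)" "\<not> (p \<and> r)" "\<not> (p \<and> s)"
    "\<not> (q \<and> r)" "\<not> (q \<and> s)" "\<not> (r \<and> s)"
  shows "exactly_one [p, q, r, s]"
proof -
  have *: "i < length [p, q, r, s] \<and> [p, q, r, s] ! i \<longleftrightarrow>
      i = 0 \<and> p \<or> i = 1 \<and> q \<or> i = 2 \<and> r \<or> i = 3 \<and> s" for i :: nat
    by (auto simp: less_Suc_eq numeral_2_eq_2 numeral_3_eq_3)
  show ?thesis unfolding exactly_one_def * using assms by auto
qed

section \<open>Groups without loxodromic elements in bounded geometry, and the four cases\<close>

locale bounded_geometry_action = proper_hyperbolic_action +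
  assumes integral: "x \<in> V \<Longrightarrow> y \<in> V \<Longrightarrow> d x y \<in> \<nat>"
    and geodesic: "x \<in> V \<Longrightarrow> y \<in> V \<Longrightarrow> real t \<le> d x y \<Longrightarrow>
      \<exists>z\<in>V. d x z = real t \<and> d z y = d x y - real t"
    and uniformly_finite: "\<exists>N. \<forall>x\<in>V. finite {y \<in> V. d x y \<le> r} \<and> card {y \<in> V. d x y \<le> r} \<le> N"
begin

text \<open>If the largest displacement of \<open>x\<close> under \<open>F\<close> is big, then all the points \<open>g x\<close> and \<open>g\<^sup>-\<^sup>1 x\<close>
  with nearly maximal displacement lie in the same direction as seen from \<open>x\<close>, and moving \<open>x\<close> in that
  direction by a distance \<open>t > 3 \<delta>\<close> decreases the largest displacement.\<close>

lemma small_joint_displacement: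
  assumes none: "\<And>g. g \<in> carrier G \<Longrightarrow> \<not> loxodromic V d G \<phi> g"
  shows "\<exists>C. \<forall>F. finite F \<longrightarrow> F \<subseteq> carrier G \<longrightarrow> (\<exists>x\<in>V. \<forall>g\<in>F. d x (\<phi> g x) \<le> C)"
proof -
  \<comment> \<open>The gain \<open>2 * real t\<close> must exceed \<open>6 * \<delta>\<close>, the
    total error in the four-point estimate below.\<close>
  define t where "t = nat \<lceil>3 * \<delta>\<rceil> + 1"
  have t: "3 * \<delta> < real t"
    using real_nat_ceiling_ge[of "3 * \<delta>"] by (simp add: t_def)
  have "\<exists>x\<in>V. \<forall>g\<in>F. d x (\<phi> g x) \<le> 4 * real t + 5 * \<delta>"
    if F: "finite F" "F \<subseteq> carrier G" for F
  proof (rule ccontr)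
    assume neg: "\<not> (\<exists>x\<in>V. \<forall>g\<in>F. d x (\<phi> g x) \<le> 4 * real t + 5 * \<delta>)"
    then have "F \<noteq> {}" using nonempty by auto
    define L where "L = (\<lambda>x. Max ((\<lambda>g. d x (\<phi> g x)) ` F))"
    have L_ge: "d x (\<phi> g x) \<le> L x" if "g \<in> F" for g x
      unfolding L_def using that F by (intro Max_ge) auto
    have L_attained: "\<exists>g\<in>F. L x = d x (\<phi> g x)" for x
    proof -
      have "L x \<in> (\<lambda>g. d x (\<phi> g x)) ` F"
        unfolding L_def using F \<open>F \<noteq> {}\<close> by (intro Max_in) auto
      then show ?thesis by blast
    qed
    have L_nat: "L x \<in> \<nat>" if "x \<in> V" for x
      using L_attained[of x] integral that F by auto
    obtain x0 where "x0 \<in> V" using nonempty by blast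
    \<comment> \<open>Displacements are natural numbers, so the largest displacement
      \<open>L\<close> attains a minimum over \<open>V\<close>.\<close>
    then obtain x where x: "x \<in> V" and "\<And>y. y \<in> V \<Longrightarrow> nat \<lfloor>L x\<rfloor> \<le> nat \<lfloor>L y\<rfloor>"
      using ex_has_least_nat[of "\<lambda>x. x \<in> V" x0 "\<lambda>x. nat \<lfloor>L x\<rfloor>"] by blast
    then have L_min: "L x \<le> L y" if "y \<in> V" for y
      using L_nat[OF x] L_nat[OF that] that by (force elim!: Nats_cases)
    obtain g where g: "g \<in> F" "L x = d x (\<phi> g x)" using L_attained by blast
    have gG: "g \<in> carrier G" using g F by blast
    have big: "L x > 4 * real t + 5 * \<delta>" using neg x L_ge by (meson not_le order_trans)
    then have "real t \<le> d x (\<phi> g x)" using g delta_nonneg by simp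
    then obtain y where y: "y \<in> V" "d x y = real t" "d y (\<phi> g x) = L x - real t"
      using geodesic[of x "\<phi> g x" t] x gG g by auto
    have toward: "d y (\<phi> h x) \<le> d x (\<phi> h x) - real t + 2 * \<delta>"
      if h: "h \<in> carrier G" and far: "d x (\<phi> h x) \<ge> L x - 2 * real t" for h
    proof -
      have "gp x y (\<phi> g x) = real t" using y g by (simp add: gromov_product_def commute)
      \<comment> \<open>Here \<open>L x - 2 * real t\<close> exceeds
        \<open>2 * real t + 5 * \<delta>\<close>, the threshold for products above
        \<open>real t\<close>; this dictates the constant
        \<open>4 * real t + 5 * \<delta>\<close>.\<close>
      moreover have "real t < gp x (\<phi> g x) (\<phi> h x)"
        by (rule gp_large_if_no_loxodromic[OF none]) (use x h gG far big g in auto)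
      ultimately have "real t - \<delta> \<le> gp x y (\<phi> h x)"
        using hyperbolic[of x y "\<phi> g x" "\<phi> h x"] x y gG h by simp
      then show ?thesis using y by (simp add: gromov_product_def commute)
    qed
    have "d y (\<phi> h y) < L x" if h: "h \<in> F" for h
    proof -
      have hG: "h \<in> carrier G" using h F by blast
      have iso: "d (\<phi> h x) (\<phi> h y) = real t" using isometric[OF hG x y(1)] y by simp
      show ?thesis
      proof (cases "d x (\<phi> h x) \<ge> L x - 2 * real t")
        case True
        have inv: "d (\<phi> (inv h) u) v = d u (\<phi> h v)" if "u \<in> V" "v \<in> V" for u v
          using isometric[of h "\<phi> (inv h) u" v] that hG by (simp flip: act_mult)
        have "d y (\<phi> h x) \<le> d x (\<phi> h x) - real t + 2 * \<delta>"
          by (rule toward[OF hG True])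
        \<comment> \<open>\<open>inv h\<close> moves \<open>x\<close> as far as \<open>h\<close>
          does, so \<open>toward\<close> applies to it although it need not lie in \<open>F\<close>;
          applying \<open>h\<close> turns the result into a bound for
          \<open>d x (\<phi> h y)\<close>.\<close>
        moreover have "d x (\<phi> h y) \<le> d x (\<phi> h x) - real t + 2 * \<delta>"
          using toward[of "inv h"] True hG x y inv[of x x] inv[of x y]
          by (simp add: commute[of x "\<phi> (inv h) x"] commute[of y "\<phi> (inv h) x"])
        moreover have "d y (\<phi> h y) + d x (\<phi> h x)
          \<le> max (d y x + d (\<phi> h y) (\<phi> h x)) (d y (\<phi> h x) + d x (\<phi> h y)) + 2 * \<delta>"
          by (rule four_point) (use x y hG in auto)
        moreover have "d y x = real t" "d (\<phi> h y) (\<phi> h x) = real t"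
          using y iso by (simp_all add: commute)
        ultimately show ?thesis
          using True L_ge[OF h, of x] big t delta_nonneg unfolding max_def by argo
      next
        case False
        have "d y (\<phi> h y) \<le> d y x + d x (\<phi> h x) + d (\<phi> h x) (\<phi> h y)"
          using triangle[of y x "\<phi> h y"] triangle[of x "\<phi> h x" "\<phi> h y"] x y hG by simp
        then show ?thesis using False y iso by (simp add: commute)
      qed
    qed
    then have "L y < L x" using L_attained[of y] by auto
    with L_min[OF y(1)] show False by simp
  qed
  then show ?thesis by blast
qed

text \<open>Let \<open>B n\<close> be the balls in the word metric. For a point \<open>x\<close> moved by at most \<open>C\<close> by all elements of
  \<open>B N\<close>, where \<open>N\<close> bounds the size of the \<open>C\<close>-balls of \<open>V\<close>, the increasing sets \<open>B n x\<close> must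
  stabilise before \<open>n = N\<close>, so that the orbit of \<open>x\<close> is finite.\<close>

lemma finite_generate:
  assumes none: "\<And>g. g \<in> carrier G \<Longrightarrow> \<not> loxodromic V d G \<phi> g"
    and S: "finite S" "S \<subseteq> carrier G"
  shows "finite (generate G S)"
proof -
  obtain C where C: "\<And>F. finite F \<Longrightarrow> F \<subseteq> carrier G \<Longrightarrow> \<exists>x\<in>V. \<forall>g\<in>F. d x (\<phi> g x) \<le> C"
    using small_joint_displacement[OF none] by blast
  obtain N where N: "\<And>x. x \<in> V \<Longrightarrow> finite {y \<in> V. d x y \<le> C} \<and> card {y \<in> V. d x y \<le> C} \<le> N"
    using uniformly_finite by blast
  \<comment> \<open>\<open>\<one>\<close> makes the sets \<open>Y n\<close> increase; with the
    inverses, stability under \<open>T\<close> suffices for stability under the generated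
    subgroup.\<close>
  define T where "T = insert \<one> (S \<union> m_inv G ` S)"
  have T: "finite T" "T \<subseteq> carrier G" using S by (auto simp: T_def)
  define B where "B = (\<lambda>n. ((\<lambda>A. (\<lambda>(t, b). t \<otimes> b) ` (T \<times> A)) ^^ n) {\<one>})"
  have B0: "B 0 = {\<one>}" and BS: "\<And>n. B (Suc n) = (\<lambda>(t, b). t \<otimes> b) ` (T \<times> B n)"
    by (simp_all add: B_def)
  have B: "finite (B n) \<and> B n \<subseteq> carrier G" for n
    by (induction n) (use T in \<open>auto simp: B0 BS\<close>)
  obtain x where x: "x \<in> V" "\<And>g. g \<in> B N \<Longrightarrow> d x (\<phi> g x) \<le> C" using C[of "B N"] B by blast
  define Y where "Y = (\<lambda>n. (\<lambda>g. \<phi> g x) ` B n)"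
  have Y_step: "\<phi> t y \<in> Y (Suc n)" if t: "t \<in> T" and y: "y \<in> Y n" for t y n
  proof -
    obtain b where b: "b \<in> B n" "y = \<phi> b x" using y by (auto simp: Y_def)
    then have "\<phi> t y = \<phi> (t \<otimes> b) x" using t B T x by (subst act_mult) auto
    then show ?thesis using b t by (auto simp: Y_def BS intro!: imageI)
  qed
  have YV: "Y n \<subseteq> V" for n using B[of n] x by (auto simp: Y_def)
  have Y_Suc: "Y n \<subseteq> Y (Suc n)" for n
  proof
    fix y assume "y \<in> Y n"
    then show "y \<in> Y (Suc n)" using Y_step[of \<one> y n] YV[of n] by (auto simp: T_def)
  qed
  have Y_mono: "Y m \<subseteq> Y n" if "m \<le> n" for m n
    using that by (rule lift_Suc_mono_le[of Y, OF Y_Suc])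
  have Y_fin: "finite (Y n)" for n using B by (simp add: Y_def)
  have YC: "Y N \<subseteq> {y \<in> V. d x y \<le> C}" using x YV by (auto simp: Y_def)
  have "\<exists>j<N. Y j = Y (Suc j)"
  proof (rule ccontr)
    assume *: "\<not> (\<exists>j<N. Y j = Y (Suc j))"
    \<comment> \<open>Strict growth up to \<open>N\<close> would put more than \<open>N\<close>
      points into a ball with at most \<open>N\<close>.\<close>
    have "j < card (Y j)" if "j \<le> N" for j
      using that
    proof (induction j)
      case 0
      then show ?case by (simp add: Y_def B0)
    next
      case (Suc j)
      then have "Y j \<subset> Y (Suc j)" using * Y_Suc[of j] by auto
      then have "card (Y j) < card (Y (Suc j))" using Y_fin by (intro psubset_card_mono)
      with Suc show ?case by simp
    qed
    moreover have "card (Y N) \<le> N"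
      using N[OF x(1)] YC card_mono order_trans by blast
    ultimately show False by fastforce
  qed
  then obtain j where j: "j < N" "Y j = Y (Suc j)" by blast
  have inv: "\<phi> g y \<in> Y j" if "g \<in> generate G S" "y \<in> Y j" for g y
    using that
  proof (induction arbitrary: y rule: generate.induct)
    case one
    then show ?case using YV[of j] by auto
  next
    case (incl h)
    then show ?case using Y_step[of h y j] j by (simp add: T_def)
  next
    case (inv h)
    then show ?case using Y_step[of "inv h" y j] j by (simp add: T_def)
  next
    case (eng h1 h2)
    have "h1 \<in> carrier G" "h2 \<in> carrier G" "y \<in> V"
      using eng generate_in_carrier[OF S(2)] YV[of j] by auto
    with eng show ?case by (simp add: act_mult)
  qed
  have "x \<in> Y j" using Y_mono[of 0 j] x by (auto simp: Y_def B0)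
  then have "generate G S \<subseteq> {g \<in> carrier G. d x (\<phi> g x) \<le> C}"
    using inv[of _ x] Y_mono[of j N] YC j(1) generate_in_carrier[OF S(2)] by fastforce
  then show ?thesis using proper[OF x(1), of C] finite_subset by blast
qed

text \<open>An infinite group without loxodromic elements is in the third case; with one,
  \<open>loxodromic_dichotomy\<close> gives the second or the fourth. A loxodromic element excludes
  the first and third cases, a finite group is finitely generated, and
  \<open>not_virtually_cyclic_if_general\<close> separates the second from the fourth.\<close>

theorem classification:
  "exactly_one
    [finite (carrier G),
     infinite (carrier G) \<and> virtually_cyclic G \<and> (\<exists>g\<in>carrier G. loxodromic V d G \<phi> g),
     \<not> finitely_generated_group G \<and> locally_finite_group G \<and> parabolic_action V d G \<phi> \<and>
       (\<forall>g\<in>carrier G. elliptic V d G \<phi> g),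
     general_action V d G \<phi>]"
proof (rule exactly_one_of_four)
  have iii: "\<not> finitely_generated_group G \<and> locally_finite_group G \<and> parabolic_action V d G \<phi> \<and>
       (\<forall>g\<in>carrier G. elliptic V d G \<phi> g)"
    if none: "\<And>g. g \<in> carrier G \<Longrightarrow> \<not> loxodromic V d G \<phi> g" and inf: "infinite (carrier G)"
  proof (intro conjI ballI)
    show "\<not> finitely_generated_group G"
      unfolding finitely_generated_group_def using finite_generate[OF none] inf by metis
    show "locally_finite_group G"
      unfolding locally_finite_group_def finitely_generated_group_def
    proof (intro allI impI, elim conjE exE)
      fix H S assume H: "subgroup H G" and S: "finite S" "S \<subseteq> carrier (G\<lparr>carrier := H\<rparr>)"
        "generate (G\<lparr>carrier := H\<rparr>) S = carrier (G\<lparr>carrier := H\<rparr>)"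
      then have "generate G S = H" using generate_consistent[of S H] by simp
      moreover have "S \<subseteq> carrier G" using S subgroup.subset[OF H] by auto
      ultimately show "finite H" using finite_generate[OF none S(1)] by simp
    qed
    show "parabolic_action V d G \<phi>" by (rule parabolic_if_no_loxodromic[OF none inf])
    show "elliptic V d G \<phi> g" if g: "g \<in> carrier G" for g
      using finite_generate[OF none, of "carrier G \<inter> {g}"] g
      by (intro elliptic_if_finite_order) (simp_all add: carrier_subgroup_generated)
  qed
  show "finite (carrier G) \<or>
     infinite (carrier G) \<and> virtually_cyclic G \<and> (\<exists>g\<in>carrier G. loxodromic V d G \<phi> g) \<or>
     \<not> finitely_generated_group G \<and> locally_finite_group G \<and> parabolic_action V d G \<phi> \<and>
       (\<forall>g\<in>carrier G. elliptic V d G \<phi> g) \<or>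
     general_action V d G \<phi>"
    using iii loxodromic_dichotomy by blast
  have "generate G (carrier G) = carrier G"
    using generate_incl[of "carrier G"] generate.incl[of _ "carrier G" G] by blast
  then have "finite (carrier G) \<Longrightarrow> finitely_generated_group G"
    unfolding finitely_generated_group_def by blast
  then show "\<not> (finite (carrier G) \<and> \<not> finitely_generated_group G \<and> locally_finite_group G \<and>
      parabolic_action V d G \<phi> \<and> (\<forall>g\<in>carrier G. elliptic V d G \<phi> g))" by blast
  have gen: "\<exists>g\<in>carrier G. loxodromic V d G \<phi> g" if "general_action V d G \<phi>"
    using that by (auto simp: general_action_def)
  show "\<not> (finite (carrier G) \<and> general_action V d G \<phi>)"
    using gen infinite_if_loxodromic by blast
  show "\<not> ((infinite (carrier G) \<and> virtually_cyclic G \<and> (\<exists>g\<in>carrier G. loxodromic V d G \<phi> g)) \<and>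
      general_action V d G \<phi>)"
    using not_virtually_cyclic_if_general by blast
  show "\<not> ((infinite (carrier G) \<and> virtually_cyclic G \<and> (\<exists>g\<in>carrier G. loxodromic V d G \<phi> g)) \<and>
      \<not> finitely_generated_group G \<and> locally_finite_group G \<and> parabolic_action V d G \<phi> \<and>
       (\<forall>g\<in>carrier G. elliptic V d G \<phi> g))"
    using loxodromic_not_elliptic by blast
  show "\<not> ((\<not> finitely_generated_group G \<and> locally_finite_group G \<and> parabolic_action V d G \<phi> \<and>
       (\<forall>g\<in>carrier G. elliptic V d G \<phi> g)) \<and> general_action V d G \<phi>)"
    using gen loxodromic_not_elliptic by blast
qed blast

end

section \<open>Actions on graphs of bounded valence\<close>

lemma walk_betw_take:
  assumes "walk_betw V E u p v" "t < length p"
  shows "walk_betw V E u (take (Suc t) p) (p ! t)"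
  using assms unfolding walk_betw_def
  by (intro conjI)
    (auto simp: successively_conv_nth take_Suc_conv_app_nth[symmetric] last_conv_nth dest: in_set_takeD)

lemma walk_betw_drop:
  assumes "walk_betw V E u p v" "t < length p"
  shows "walk_betw V E (p ! t) (drop t p) v"
  using assms by (auto simp: walk_betw_def hd_drop_conv_nth successively_conv_nth dest: in_set_dropD)

context connected_graph
begin

text \<open>Cutting a shortest walk at its vertex with index \<open>t\<close> bounds both distances
  from above, and the triangle inequality forces equality.\<close>

lemma graph_dist_geodesic:
  assumes "u \<in> V" "v \<in> V" "real t \<le> graph_dist V E u v"
  shows "\<exists>z\<in>V. graph_dist V E u z = real t \<and> graph_dist V E z v = graph_dist V E u v - real t"
proof -
  obtain p n where p: "walk_betw V E u p v" "length p = Suc n" "graph_dist V E u v = real n"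
    using shortest_walk assms by blast
  with assms have t: "t \<le> n" "t < length p" by auto
  have z: "p ! t \<in> V" using p t by (auto simp: walk_betw_def)
  have "graph_dist V E u (p ! t) \<le> real t"
    using graph_dist_le[OF walk_betw_take[OF p(1) t(2)]] t p by simp
  moreover have "graph_dist V E (p ! t) v \<le> real (n - t)"
    using graph_dist_le[OF walk_betw_drop[OF p(1) t(2)], of "n - t"] t p by (simp add: Suc_diff_le)
  moreover have "graph_dist V E u v \<le> graph_dist V E u (p ! t) + graph_dist V E (p ! t) v"
    using Metric_space.triangle[OF Metric_space_graph_dist] assms z by blast
  ultimately show ?thesis using p t z by (intro bexI[of _ "p ! t"]) (simp_all add: of_nat_diff)
qed

lemma edge_if_graph_dist_1:
  assumes "u \<in> V" "v \<in> V" "graph_dist V E u v = 1"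
  shows "{u, v} \<in> E"
proof -
  obtain p n where "walk_betw V E u p v" "length p = Suc n" "graph_dist V E u v = real n"
    using shortest_walk assms(1,2) by blast
  then show ?thesis
    using assms by (auto simp: walk_betw_def length_Suc_conv)
qed

text \<open>Induction on integral radii: distances are integers, so a vertex of the next sphere is
  adjacent to a vertex of the current ball, which bounds the next ball by
  \<open>N + N * k\<close>.\<close>

lemma balls_uniformly_finite:
  assumes "bounded_valence V E"
  shows "\<exists>N. \<forall>x\<in>V. finite {y \<in> V. graph_dist V E x y \<le> r} \<and> card {y \<in> V. graph_dist V E x y \<le> r} \<le> N"
proof -
  let ?B = "\<lambda>x r. {y \<in> V. graph_dist V E x y \<le> r}"
  obtain k where k: "\<And>v. v \<in> V \<Longrightarrow> finite {u. {u, v} \<in> E} \<and> card {u. {u, v} \<in> E} \<le> k"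
    using assms by (auto simp: bounded_valence_def)
  have nat: "\<exists>N. \<forall>x\<in>V. finite (?B x (real n)) \<and> card (?B x (real n)) \<le> N" for n
  proof (induction n)
    case 0
    interpret Metric_space V "graph_dist V E" by (rule Metric_space_graph_dist)
    have "?B x (real 0) = {x}" if "x \<in> V" for x
    proof -
      have "y = x" if "y \<in> V" "graph_dist V E x y \<le> 0" for y
      proof -
        have "graph_dist V E x y = 0" using that nonneg[of x y] by linarith
        then show ?thesis using zero[OF \<open>x \<in> V\<close> \<open>y \<in> V\<close>] by simp
      qed
      then show ?thesis using that by auto
    qed
    then show ?case by (intro exI[of _ 1]) simp
  next
    case (Suc n)
    then obtain N where N: "\<And>x. x \<in> V \<Longrightarrow> finite (?B x (real n)) \<and> card (?B x (real n)) \<le> N" by blast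
    have "finite (?B x (real (Suc n))) \<and> card (?B x (real (Suc n))) \<le> N + N * k" if x: "x \<in> V" for x
    proof -
      let ?A = "?B x (real n)"
      let ?U = "\<Union>z\<in>?A. {u. {u, z} \<in> E}"
      have A: "finite ?A" "card ?A \<le> N" using N x by auto
      have "card ?U \<le> (\<Sum>z\<in>?A. card {u. {u, z} \<in> E})" by (rule card_UN_le[OF A(1)])
      also have "\<dots> \<le> (\<Sum>z\<in>?A. k)" by (rule sum_mono) (use k in auto)
      also have "\<dots> \<le> N * k" using A by simp
      finally have U: "card ?U \<le> N * k" .
      have fin: "finite (?A \<union> ?U)" using A k by auto
      have sub: "?B x (real (Suc n)) \<subseteq> ?A \<union> ?U"
      proof
        fix y assume y: "y \<in> ?B x (real (Suc n))"
        show "y \<in> ?A \<union> ?U"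
        proof (cases "y \<in> ?A")
          case False
          then have "graph_dist V E x y = real (Suc n)"
            using y unfolding graph_dist_def by auto
          with graph_dist_geodesic[of x y n] x y obtain z where
            z: "z \<in> V" "graph_dist V E x z = real n" "graph_dist V E z y = 1" by auto
          then have "{y, z} \<in> E" using edge_if_graph_dist_1[of z y] y by (simp add: insert_commute)
          with z show ?thesis by auto
        qed simp
      qed
      have "card (?B x (real (Suc n))) \<le> card (?A \<union> ?U)" by (rule card_mono[OF fin sub])
      also have "\<dots> \<le> N + N * k" using card_Un_le[of ?A ?U] A U by linarith
      finally show ?thesis using finite_subset[OF sub fin] by blast
    qed
    then show ?case by blast
  qed
  from nat[of "nat \<lceil>r\<rceil>"] obtain N where
    N: "\<And>x. x \<in> V \<Longrightarrow> finite (?B x (real (nat \<lceil>r\<rceil>))) \<and> card (?B x (real (nat \<lceil>r\<rceil>))) \<le> N" by blast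
  have sub: "?B x r \<subseteq> ?B x (real (nat \<lceil>r\<rceil>))" for x
    using real_nat_ceiling_ge[of r] by auto
  have "finite (?B x r) \<and> card (?B x r) \<le> N" if "x \<in> V" for x
    using N[OF that] card_mono[OF _ sub[of x]] finite_subset[OF sub[of x]] by (meson order_trans)
  then show ?thesis by blast
qed

end

section \<open>Graph automorphisms as isometries and properness of the action\<close>

context graph_action
begin

lemma walk_betw_map:
  assumes "g \<in> carrier G" "walk_betw V E u p v"
  shows "walk_betw V E (\<phi> g u) (map (\<phi> g) p) (\<phi> g v)"
proof -
  have "\<phi> g y \<in> V" if "y \<in> V" for y using element_image assms(1) that by blast
  moreover have "p ! i \<in> V" if "i < length p" for i
    using assms(2) that by (auto simp: walk_betw_def)
  ultimately show ?thesis
    using assms automorphism[OF assms(1)]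
    by (auto simp: walk_betw_def hd_map last_map successively_conv_nth)
qed

lemma graph_dist_action_le:
  assumes "connected_graph V E" "g \<in> carrier G" "u \<in> V" "v \<in> V"
  shows "graph_dist V E (\<phi> g u) (\<phi> g v) \<le> graph_dist V E u v"
proof -
  obtain p n where p: "walk_betw V E u p v" "length p = Suc n" "graph_dist V E u v = real n"
    using connected_graph.shortest_walk assms by metis
  then show ?thesis using graph_dist_le[OF walk_betw_map[OF assms(2) p(1)], of n] by simp
qed

lemma action_inv [simp]:
  assumes "g \<in> carrier G" "u \<in> V"
  shows "\<phi> (inv g) (\<phi> g u) = u" "\<phi> g (\<phi> (inv g) u) = u"
proof -
  interpret group G using group_hom by (simp add: group_hom_def)
  have one: "\<phi> \<one> u = u" using assms by (metis id_eq_one restrict_apply)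
  show "\<phi> (inv g) (\<phi> g u) = u" "\<phi> g (\<phi> (inv g) u) = u"
    using composition_rule[of u "inv g" g] composition_rule[of u g "inv g"] assms one by auto
qed

lemma graph_dist_action:
  assumes "connected_graph V E" "g \<in> carrier G" "u \<in> V" "v \<in> V"
  shows "graph_dist V E (\<phi> g u) (\<phi> g v) = graph_dist V E u v"
proof -
  interpret group G using group_hom by (simp add: group_hom_def)
  have "\<phi> g u \<in> V" "\<phi> g v \<in> V" using element_image assms by blast+
  then have "graph_dist V E u v \<le> graph_dist V E (\<phi> g u) (\<phi> g v)"
    using graph_dist_action_le[OF assms(1), of "inv g" "\<phi> g u" "\<phi> g v"] assms by simp
  with graph_dist_action_le[OF assms] show ?thesis by simp
qed

text \<open>An element fixing the vertices in the support of a point of the realisation fixes the point.\<close>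

lemma finite_pointwise_stabilizer:
  assumes p: "p \<in> realization_points V E"
    and fin: "finite (stabilizer G (realization_action G V \<phi>) p)"
  obtains A where "finite A" "A \<noteq> {}" "A \<subseteq> V" "finite {g \<in> carrier G. \<forall>a\<in>A. \<phi> g a = a}"
proof
  interpret group G using group_hom by (simp add: group_hom_def)
  let ?A = "{v. p v \<noteq> 0}"
  \<comment> \<open>A vertex counts as the degenerate pair \<open>{v, v}\<close>, so that both kinds
    of support are treated alike.\<close>
  have "(\<exists>v\<in>V. ?A = {v, v}) \<or> ?A \<in> E" using p by (auto simp: realization_points_def)
  then obtain u v where "u \<in> V" "v \<in> V" and A: "?A = {u, v}" using edges[of ?A] by metis
  then have "finite ?A \<and> ?A \<noteq> {} \<and> ?A \<subseteq> V" unfolding A by simp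
  then show "finite ?A" "?A \<noteq> {}" and sub: "?A \<subseteq> V" by blast+
  have "realization_action G V \<phi> g p = p"
    if g: "g \<in> carrier G" and fix_A: "\<And>a. a \<in> ?A \<Longrightarrow> \<phi> g a = a" for g
  proof
    fix v
    show "realization_action G V \<phi> g p v = p v"
    proof (cases "v \<in> V")
      case False
      then show ?thesis using sub by (auto simp: realization_action_def)
    next
      case True
      have "p (\<phi> (inv g) v) = p v"
      proof (cases "v \<in> ?A")
        case True
        then show ?thesis using fix_A[OF True] action_inv(1)[OF g, of v] sub by auto
      next
        case False
        have "\<phi> (inv g) v \<notin> ?A"
        proof
          assume "\<phi> (inv g) v \<in> ?A"
          then have "\<phi> (inv g) v = v" using fix_A action_inv(2)[OF g True] by metis
          with \<open>\<phi> (inv g) v \<in> ?A\<close> False show False by simp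
        qed
        with False show ?thesis by simp
      qed
      with True show ?thesis by (simp add: realization_action_def)
    qed
  qed
  then have "{g \<in> carrier G. \<forall>a\<in>?A. \<phi> g a = a} \<subseteq> stabilizer G (realization_action G V \<phi>) p"
    by (auto simp: stabilizer_def)
  then show "finite {g \<in> carrier G. \<forall>a\<in>?A. \<phi> g a = a}" using fin finite_subset by blast
qed

text \<open>An element that moves \<open>x\<close> by at most \<open>r\<close> moves each
  \<open>a\<close> in \<open>A\<close> by at most \<open>r\<close> plus twice the distance from
  \<open>x\<close> to \<open>a\<close>, so only finitely many restrictions to \<open>A\<close>
  occur. Elements with the same restriction lie in one coset of the finite pointwise stabiliser of
  \<open>A\<close>.\<close>

lemma action_proper:
  assumes conn: "connected_graph V E"
    and balls: "\<And>x r. x \<in> V \<Longrightarrow> finite {y \<in> V. graph_dist V E x y \<le> r}"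
    and A: "finite A" "A \<subseteq> V" "finite {g \<in> carrier G. \<forall>a\<in>A. \<phi> g a = a}"
    and x: "x \<in> V"
  shows "finite {g \<in> carrier G. graph_dist V E x (\<phi> g x) \<le> r}"
proof -
  interpret group G using group_hom by (simp add: group_hom_def)
  let ?d = "graph_dist V E"
  interpret Metric_space V ?d by (rule connected_graph.Metric_space_graph_dist[OF conn])
  have act: "\<phi> g y \<in> V" if "g \<in> carrier G" "y \<in> V" for g y using element_image that by blast
  define P where "P = (PiE A (\<lambda>a. {y \<in> V. ?d a y \<le> r + 2 * ?d x a}))"
  define h where "h = (\<lambda>g. restrict (\<phi> g) A)"
  have "finite P" unfolding P_def using A balls by (intro finite_PiE) auto
  moreover have "finite (h -` {f} \<inter> carrier G)" for f
  proof (cases "h -` {f} \<inter> carrier G = {}")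
    case False
    then obtain g0 where g0: "g0 \<in> carrier G" "h g0 = f" by blast
    have "h -` {f} \<inter> carrier G \<subseteq> (\<lambda>s. g0 \<otimes> s) ` {g \<in> carrier G. \<forall>a\<in>A. \<phi> g a = a}"
    proof
      fix g assume "g \<in> h -` {f} \<inter> carrier G"
      then have g: "g \<in> carrier G" "h g = h g0" using g0 by auto
      have "\<phi> (inv g0 \<otimes> g) a = a" if a: "a \<in> A" for a
      proof -
        have aV: "a \<in> V" using a A by blast
        have "\<phi> g a = \<phi> g0 a" using g(2) a unfolding h_def by (metis restrict_apply')
        then show ?thesis using composition_rule[of a "inv g0" g] g g0 aV by simp
      qed
      moreover have "g = g0 \<otimes> (inv g0 \<otimes> g)" using g g0 by (simp flip: m_assoc)
      ultimately show "g \<in> (\<lambda>s. g0 \<otimes> s) ` {g \<in> carrier G. \<forall>a\<in>A. \<phi> g a = a}"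
        using g g0 by blast
    qed
    then show ?thesis using A(3) finite_surj by blast
  qed simp
  ultimately have "finite (h -` P \<inter> carrier G)" by (rule finite_finite_vimage_IntI)
  moreover have "{g \<in> carrier G. ?d x (\<phi> g x) \<le> r} \<subseteq> h -` P \<inter> carrier G"
  proof
    fix g assume "g \<in> {g \<in> carrier G. ?d x (\<phi> g x) \<le> r}"
    then have g: "g \<in> carrier G" "?d x (\<phi> g x) \<le> r" by auto
    have "?d a (\<phi> g a) \<le> r + 2 * ?d x a" if "a \<in> A" for a
    proof -
      have a: "a \<in> V" using that A by blast
      have "?d a (\<phi> g a) \<le> ?d a x + ?d x (\<phi> g x) + ?d (\<phi> g x) (\<phi> g a)"
        using triangle[of a x "\<phi> g a"] triangle[of x "\<phi> g x" "\<phi> g a"] a x g act by simp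
      then show ?thesis using graph_dist_action[OF conn g(1) x a] g commute[of a x] by simp
    qed
    then show "g \<in> h -` P \<inter> carrier G"
      using g act A by (auto simp: P_def h_def)
  qed
  ultimately show ?thesis by (rule rev_finite_subset)
qed

end

theorem proposition8p1:
  fixes V :: "'v set" and E :: "'v set set"
    and G :: "('g, 'c) monoid_scheme" and \<phi> :: "'g \<Rightarrow> 'v \<Rightarrow> 'v"
  assumes "connected_graph V E"
    and "gromov_hyperbolic V (graph_dist V E)"
    and "bounded_valence V E"
    and "graph_action V E G \<phi>"
    and "\<exists>p\<in>realization_points V E. finite (stabilizer G (realization_action G V \<phi>) p)"
  shows "exactly_one
    [finite (carrier G),
     infinite (carrier G) \<and> virtually_cyclic G \<and>
       (\<exists>g\<in>carrier G. loxodromic V (graph_dist V E) G \<phi> g),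
     \<not> finitely_generated_group G \<and> locally_finite_group G \<and>
       parabolic_action V (graph_dist V E) G \<phi> \<and>
       (\<forall>g\<in>carrier G. elliptic V (graph_dist V E) G \<phi> g),
     general_action V (graph_dist V E) G \<phi>]"
proof -
  interpret connected_graph V E by (rule assms(1))
  interpret graph_action V E G \<phi> by (rule assms(4))
  interpret Metric_space V "graph_dist V E" by (rule Metric_space_graph_dist)
  obtain \<delta> where \<delta>: "\<delta> \<ge> 0"
    "\<And>w x y z. w \<in> V \<Longrightarrow> x \<in> V \<Longrightarrow> y \<in> V \<Longrightarrow> z \<in> V \<Longrightarrow>
      gromov_product (graph_dist V E) w x z \<ge>
        min (gromov_product (graph_dist V E) w x y) (gromov_product (graph_dist V E) w y z) - \<delta>"
    using assms(2) unfolding gromov_hyperbolic_def by blast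
  obtain p where p: "p \<in> realization_points V E"
    "finite (stabilizer G (realization_action G V \<phi>) p)" using assms(5) by blast
  obtain A where A: "finite A" "A \<noteq> {}" "A \<subseteq> V" "finite {g \<in> carrier G. \<forall>a\<in>A. \<phi> g a = a}"
    by (rule finite_pointwise_stabilizer[OF p])
  note balls = balls_uniformly_finite[OF assms(3)]
  \<comment> \<open>\<open>balls\<close> serves twice: finiteness of balls gives properness, and the
    common bound on their sizes gives uniform finiteness. The set \<open>A\<close> supplies a
    vertex.\<close>
  interpret bounded_geometry_action G V \<phi> "graph_dist V E" \<delta>
  proof unfold_locales
    show "finite {g \<in> carrier G. graph_dist V E x (\<phi> g x) \<le> r}" if "x \<in> V" for x r
      using action_proper[OF assms(1) _ A(1,3,4) that, of r] balls by blast
    show "graph_dist V E x y \<in> \<nat>" for x y by (simp add: graph_dist_def)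
  qed (use \<delta> A balls graph_dist_geodesic graph_dist_action[OF assms(1)] triangle commute in auto)
  show ?thesis by (rule classification)
qed

end
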